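(* Let $r\geq 2$ be an integer, let $c=r^{-(2r+9)(r+1)}$, let $n\geq e^{2/c}$, and let $G$ be a graph of order $n$. If $\mu(G)>\mu(T_r(n))$, then $G$ contains a (not necessarily induced) subgraph isomorphic to $K_r^{+}(\lfloor c\ln n\rfloor,\ldots,\lfloor c\ln n\rfloor)$ (all $r$ parts of size $\lfloor c\ln n\rfloor$).
   Context: All graphs are finite and simple; $\ln$ is the natural logarithm. For a graph $G$, $\mu(G)$ denotes the largest eigenvalue of the adjacency matrix of $G$. $T_r(n)$ is the $r$-partite Turán graph of order $n$, i.e. the complete $r$-partite graph on $n$ vertices whose part sizes differ by at most one. For integers $s_1\geq 2, s_2,\ldots,s_r\ge 1$, $K_r^{+}(s_1,\ldots,s_r)$ denotes the complete $r$-partite graph with parts of sizes $s_1,\ldots,s_r$ together with one additional edge joining two vertices of the first part. *)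

theory Defs
  imports
    "Graph_Theory.Digraph_Isomorphism"
    "Jordan_Normal_Form.Spectral_Radius"
begin

text \<open>
  A finite simple graph is a \<^const>\<open>pair_graph\<close>: a finite vertex set with a symmetric,
  irreflexive set of arcs, each edge being represented by its two orientations.
\<close>

definition vertex_list :: "'a pair_pre_digraph \<Rightarrow> 'a list" where
  "vertex_list G = (SOME vs. distinct vs \<and> set vs = pverts G)"

definition adjacency_matrix_on :: "'a list \<Rightarrow> 'a pair_pre_digraph \<Rightarrow> real mat" where
  "adjacency_matrix_on vs G = mat (length vs) (length vs)
     (\<lambda>(i, j). if (vs ! i, vs ! j) \<in> parcs G then 1 else 0)"

definition adjacency_matrix :: "'a pair_pre_digraph \<Rightarrow> real mat" where
  "adjacency_matrix G = adjacency_matrix_on (vertex_list G) G"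

definition largest_eigenvalue :: "'a pair_pre_digraph \<Rightarrow> real" where
  "largest_eigenvalue G = Max (spectrum (adjacency_matrix G))"

text \<open>
  The list holds the part sizes; the vertex \<open>(i, j)\<close> is the \<open>j\<close>-th vertex of the \<open>i\<close>-th part.
\<close>

definition complete_multipartite :: "nat list \<Rightarrow> (nat \<times> nat) pair_pre_digraph" where
  "complete_multipartite ss =
     (let V = {(i, j). i < length ss \<and> j < ss ! i}
      in \<lparr> pverts = V, parcs = {(u, v). u \<in> V \<and> v \<in> V \<and> fst u \<noteq> fst v} \<rparr>)"

definition turan_graph :: "nat \<Rightarrow> nat \<Rightarrow> (nat \<times> nat) pair_pre_digraph" where
  "turan_graph r n =
     complete_multipartite (map (\<lambda>i. n div r + (if i < n mod r then 1 else 0)) [0..<r])"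

text \<open>Meaningful only for a first part of size at least two.\<close>

definition complete_multipartite_plus :: "nat list \<Rightarrow> (nat \<times> nat) pair_pre_digraph" where
  "complete_multipartite_plus ss =
     \<lparr> pverts = pverts (complete_multipartite ss),
       parcs = parcs (complete_multipartite ss) \<union> {((0, 0), (0, 1)), ((0, 1), (0, 0))} \<rparr>"

lemma pverts_complete_multipartite:
  "pverts (complete_multipartite ss) = (SIGMA i:{..<length ss}. {..<ss ! i})"
  by (auto simp: complete_multipartite_def Let_def)

lemma parcs_complete_multipartite:
  "parcs (complete_multipartite ss) =
     {(u, v). u \<in> pverts (complete_multipartite ss) \<and> v \<in> pverts (complete_multipartite ss)
        \<and> fst u \<noteq> fst v}"
  by (simp add: complete_multipartite_def Let_def)

lemma finite_pverts_complete_multipartite: "finite (pverts (complete_multipartite ss))"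
  by (simp add: pverts_complete_multipartite)

lemma finite_parcs_complete_multipartite: "finite (parcs (complete_multipartite ss))"
  by (rule finite_subset[of _ "pverts (complete_multipartite ss) \<times> pverts (complete_multipartite ss)"])
    (auto simp: parcs_complete_multipartite finite_pverts_complete_multipartite)

lemma pair_graph_complete_multipartite: "pair_graph (complete_multipartite ss)"
  using finite_pverts_complete_multipartite[of ss] finite_parcs_complete_multipartite[of ss]
  by unfold_locales (auto simp: symmetric_def sym_def parcs_complete_multipartite)

lemma pair_graph_complete_multipartite_plus:
  assumes "ss \<noteq> []" "ss ! 0 \<ge> 2"
  shows "pair_graph (complete_multipartite_plus ss)"
  using assms finite_pverts_complete_multipartite[of ss] finite_parcs_complete_multipartite[of ss]
  by unfold_locales
    (auto simp: complete_multipartite_plus_def symmetric_def sym_def parcs_complete_multipartite,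
     auto simp: pverts_complete_multipartite)

lemma card_complete_multipartite: "card (pverts (complete_multipartite ss)) = sum_list ss"
  by (simp add: pverts_complete_multipartite sum_list_sum_nth atLeast0LessThan)

lemma card_turan_graph:
  assumes "r > 0"
  shows "card (pverts (turan_graph r n)) = n"
proof -
  have "card (pverts (turan_graph r n)) = (\<Sum>i<r. n div r + (if i < n mod r then 1 else 0))"
    by (simp add: turan_graph_def card_complete_multipartite sum_list_sum_nth atLeast0LessThan)
  also have "\<dots> = r * (n div r) + card {i\<in>{..<r}. i < n mod r}"
    by (simp add: sum.distrib flip: sum.inter_filter)
  also have "{i\<in>{..<r}. i < n mod r} = {..<n mod r}"
    using assms mod_less_divisor[of r n] by (auto intro: less_trans)
  finally show ?thesis by simp
qed

lemma vertex_list: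
  assumes "finite (pverts G)"
  shows "distinct (vertex_list G)" "set (vertex_list G) = pverts G"
proof -
  obtain vs where "distinct vs \<and> set vs = pverts G"
    using finite_distinct_list[OF assms] by blast
  then have "distinct (vertex_list G) \<and> set (vertex_list G) = pverts G"
    unfolding vertex_list_def by (rule someI)
  then show "distinct (vertex_list G)" "set (vertex_list G) = pverts G" by auto
qed

text \<open>The spectrum does not depend on the enumeration of the vertices.\<close>

lemma eigenvalue_adjacency_matrix_on:
  assumes vs: "distinct vs" "set vs = pverts G"
  shows "eigenvalue (adjacency_matrix_on vs G) k \<longleftrightarrow>
    (\<exists>f. (\<exists>v\<in>pverts G. f v \<noteq> 0) \<and>
         (\<forall>u\<in>pverts G. (\<Sum>v\<in>pverts G. if (u, v) \<in> parcs G then f v else 0) = k * f u))"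
    (is "_ \<longleftrightarrow> ?R")
proof -
  let ?A = "adjacency_matrix_on vs G" and ?n = "length vs"
  have bij: "bij_betw ((!) vs) {..<?n} (pverts G)"
    using bij_betw_nth[OF vs(1) refl refl] vs(2) by simp
  have nz: "(vec ?n (\<lambda>i. f (vs ! i)) \<noteq> 0\<^sub>v ?n) \<longleftrightarrow> (\<exists>v\<in>pverts G. f v \<noteq> 0)"
    for f :: "'a \<Rightarrow> real"
    unfolding vs(2)[symmetric] using all_set_conv_all_nth[of vs "\<lambda>v. f v = 0"]
    by (auto simp: vec_eq_iff)
  have mv: "(?A *\<^sub>v vec ?n (\<lambda>i. f (vs ! i))) $ i =
      (\<Sum>v\<in>pverts G. if (vs ! i, v) \<in> parcs G then f v else 0)"
    if "i < ?n" for f :: "'a \<Rightarrow> real" and i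
  proof -
    have "(?A *\<^sub>v vec ?n (\<lambda>i. f (vs ! i))) $ i =
        (\<Sum>j<?n. (if (vs ! i, vs ! j) \<in> parcs G then f (vs ! j) else 0))"
      using that
      by (auto simp: adjacency_matrix_on_def scalar_prod_def atLeast0LessThan intro!: sum.cong)
    also have "\<dots> = (\<Sum>v\<in>pverts G. if (vs ! i, v) \<in> parcs G then f v else 0)"
      by (rule sum.reindex_bij_betw[OF bij])
    finally show ?thesis .
  qed
  have key: "eigenvector ?A (vec ?n (\<lambda>i. f (vs ! i))) k \<longleftrightarrow>
      (\<exists>v\<in>pverts G. f v \<noteq> 0) \<and>
      (\<forall>u\<in>pverts G. (\<Sum>v\<in>pverts G. if (u, v) \<in> parcs G then f v else 0) = k * f u)" for f
  proof -
    have dim: "dim_row ?A = ?n" by (simp add: adjacency_matrix_on_def)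
    have "?A *\<^sub>v vec ?n (\<lambda>i. f (vs ! i)) = k \<cdot>\<^sub>v vec ?n (\<lambda>i. f (vs ! i)) \<longleftrightarrow>
        (\<forall>i<?n. (\<Sum>v\<in>pverts G. if (vs ! i, v) \<in> parcs G then f v else 0) = k * f (vs ! i))"
      unfolding vec_eq_iff using mv dim by simp
    also have "\<dots> \<longleftrightarrow>
        (\<forall>u\<in>pverts G. (\<Sum>v\<in>pverts G. if (u, v) \<in> parcs G then f v else 0) = k * f u)"
      unfolding vs(2)[symmetric] by (simp only: all_set_conv_all_nth)
    finally show ?thesis using nz by (simp add: eigenvector_def dim)
  qed
  show ?thesis
  proof
    assume "eigenvalue ?A k"
    then obtain x where x: "eigenvector ?A x k" by (auto simp: eigenvalue_def)
    define f where "f v = x $ (the_inv_into {..<?n} ((!) vs) v)" for v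
    have "f (vs ! i) = x $ i" if "i < ?n" for i
      using that the_inv_into_f_f[OF bij_betw_imp_inj_on[OF bij], of i] by (simp add: f_def)
    moreover have "dim_vec x = ?n" using x by (simp add: eigenvector_def adjacency_matrix_on_def)
    ultimately have "x = vec ?n (\<lambda>i. f (vs ! i))" by (auto simp: vec_eq_iff)
    then show ?R using x key[of f] by blast
  next
    assume ?R
    then show "eigenvalue ?A k" using key by (auto simp: eigenvalue_def)
  qed
qed

end

theory Submission
  imports Defs "HOL-Analysis.Function_Topology" "HOL-Analysis.Convex"
begin

text \<open>
  Put \<open>e = 1 / (80 r\<^sup>3)\<close> and let \<open>W\<close> be a nonempty vertex set maximizing
  \<open>\<mu>(G[W]) / |W| + (e / 32) ln |W|\<close>. If some vertex of \<open>G[W]\<close> had degree at most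
  \<open>(1 - 1/r - e)|W|\<close>, the smallest entry of the Perron vector would be so small that deleting its
  vertex increases this potential; so \<open>G[W]\<close> has large minimum degree. Moreover \<open>|W|\<close> is at least a
  constant times \<open>n\<close>, and either \<open>W\<close> is everything or \<open>\<mu>(G[W]) > (1 - 1/r)|W|\<close>. In both cases
  \<open>G[W]\<close> is not \<open>r\<close>-partite, since an \<open>r\<close>-partite graph has at most the largest eigenvalue of the
  Turan graph of the same order.

  On the other hand, a graph of this minimum degree without \<open>K_r\<^sup>+(s, \<dots>, s)\<close> is \<open>r\<close>-partite.
  Greedy choice and the pigeonhole principle give a complete \<open>r\<close>-partite subgraph with parts
  \<open>A_i\<close> of size \<open>64 r\<^sup>2 s\<close>. No vertex has \<open>s\<close> neighbours in every \<open>A_i\<close>, so by counting almost all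
  vertices miss almost all of one \<open>A_i\<close> and little of the others; these vertices form \<open>r\<close> large
  independent clusters which are almost completely joined to each other. Repeating the argument with
  the clusters in place of the \<open>A_i\<close> puts every vertex into a class, and an edge inside a class
  would again produce \<open>K_r\<^sup>+(s, \<dots>, s)\<close>.
\<close>

section \<open>Complete multipartite subgraphs of dense graphs\<close>

definition nbrs :: "('a \<times> 'a) set \<Rightarrow> 'a \<Rightarrow> 'a set" where
  "nbrs E v = {w. (v, w) \<in> E}"

text \<open>An embedding of the index grid of
  \<open>complete_multipartite_plus (replicate r s)\<close>: only arcs that must be present are
  demanded, so the copy need not be induced. For \<open>s \<ge> 2\<close> the pair
  \<open>(0, 1)\<close> lies in the grid and the extra edge joins two vertices of part 0.\<close>

definition contains_plus :: "('a \<times> 'a) set \<Rightarrow> nat \<Rightarrow> nat \<Rightarrow> bool" where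
  "contains_plus E r s \<longleftrightarrow> (\<exists>f. inj_on f ({..<r} \<times> {..<s}) \<and> (f (0, 0), f (0, 1)) \<in> E \<and>
     (\<forall>i<r. \<forall>j<r. \<forall>a<s. \<forall>b<s. i \<noteq> j \<longrightarrow> (f (i, a), f (j, b)) \<in> E))"

section \<open>Assembling a copy of the target graph from large parts\<close>

lemma ex_inj_on_card_ge:
  assumes "finite P" "s \<le> card P"
  shows "\<exists>g. inj_on g {..<s::nat} \<and> g ` {..<s} \<subseteq> P"
  using assms card_le_inj[of "{..<s}" P] by auto

text \<open>Fixing the first two values lets the extra edge land on the indices 0 and 1; the rest of
  \<open>P\<close> is enumerated with a shift by 2.\<close>

lemma ex_inj_on_card_ge_pair:
  assumes "finite P" "s \<le> card P" "u \<in> P" "w \<in> P" "u \<noteq> w" "s \<ge> 2"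
  shows "\<exists>g. inj_on g {..<s::nat} \<and> g ` {..<s} \<subseteq> P \<and> g 0 = u \<and> g 1 = w"
proof -
  have "s - 2 \<le> card (P - {u, w})" using assms by (subst card_Diff_subset) auto
  then obtain h where h: "inj_on h {..<s - 2}" "h ` {..<s - 2} \<subseteq> P - {u, w}"
    using ex_inj_on_card_ge[of "P - {u,w}" "s-2"] assms by auto
  define g where "g i = (if i = 0 then u else if i = 1 then w else h (i - 2))" for i :: nat
  have hin: "h (i - 2) \<in> P - {u, w}" if "i < s" "2 \<le> i" for i
    using h(2) that by (auto simp: image_subset_iff)
  have "inj_on g {..<s}"
  proof (rule inj_onI)
    fix i j assume ij: "i \<in> {..<s}" "j \<in> {..<s}" "g i = g j"
    show "i = j"
    proof (cases "i < 2 \<or> j < 2")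
      case True
      then show ?thesis using ij hin[of i] hin[of j] \<open>u \<noteq> w\<close>
        by (auto simp: g_def less_2_cases_iff split: if_splits)
    next
      case False
      then have "h (i - 2) = h (j - 2)" using ij by (auto simp: g_def)
      then have "i - 2 = j - 2" using inj_onD[OF h(1), of "i - 2" "j - 2"] ij False by auto
      then show ?thesis using False by auto
    qed
  qed
  moreover have "g ` {..<s} \<subseteq> P"
    using hin assms by (force simp: g_def)
  ultimately show ?thesis by (intro exI[of _ g]) (auto simp: g_def)
qed

locale simple_edges =
  fixes E :: "('a \<times> 'a) set"
  assumes symE: "(u, v) \<in> E \<Longrightarrow> (v, u) \<in> E" and irreflE: "(v, v) \<notin> E"
begin

lemma mem_nbrs: "w \<in> nbrs E v \<longleftrightarrow> (v, w) \<in> E"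
  by (simp add: nbrs_def)

text \<open>Vertices of different parts are adjacent, hence distinct because there are no loops, so
  disjointness of the parts comes for free. By symmetry the extra edge may lie in any part
  \<open>P k\<close>.\<close>

lemma contains_plusI:
  assumes P: "\<And>i. i < r \<Longrightarrow> finite (P i) \<and> s \<le> card (P i)"
    and compl: "\<And>i j. i < r \<Longrightarrow> j < r \<Longrightarrow> i \<noteq> j \<Longrightarrow> P i \<times> P j \<subseteq> E"
    and "k < r" "u \<in> P k" "w \<in> P k" "(u, w) \<in> E" "s \<ge> 2"
  shows "contains_plus E r s"
proof -
  \<comment> \<open>The transposition of 0 and \<open>k\<close> moves the part with the extra edge
    to index 0.\<close>
  define Q where "Q i = P (if i = 0 then k else if i = k then 0 else i)" for i
  have "\<exists>g. inj_on g {..<s} \<and> g ` {..<s} \<subseteq> Q i \<and> (i = 0 \<longrightarrow> g 0 = u \<and> g 1 = w)" if "i < r" for i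
  proof (cases "i = 0")
    case True
    moreover have "u \<noteq> w" using irreflE assms by blast
    ultimately show ?thesis using ex_inj_on_card_ge_pair[of "P k" s u w] assms
      by (auto simp: Q_def)
  next
    case False
    have "finite (Q i) \<and> s \<le> card (Q i)" using P assms that by (auto simp: Q_def)
    then show ?thesis using ex_inj_on_card_ge[of "Q i" s] False by auto
  qed
  then obtain g where g: "\<And>i. i < r \<Longrightarrow> inj_on (g i) {..<s}"
    "\<And>i. i < r \<Longrightarrow> g i ` {..<s} \<subseteq> Q i" "\<And>i. i < r \<Longrightarrow> i = 0 \<longrightarrow> g i 0 = u \<and> g i 1 = w"
    by metis
  have Q: "Q i \<times> Q j \<subseteq> E" if "i < r" "j < r" "i \<noteq> j" for i j
    unfolding Q_def by (rule compl) (use that \<open>k < r\<close> in auto)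
  have adj: "(g i a, g j b) \<in> E" if "i < r" "j < r" "i \<noteq> j" "a < s" "b < s" for i j a b
    using Q[OF that(1-3)] g(2)[OF that(1)] g(2)[OF that(2)] that by blast
  have "inj_on (\<lambda>(i, a). g i a) ({..<r} \<times> {..<s})"
  proof (rule inj_onI, clarsimp)
    fix i a j b assume *: "i < r" "a < s" "j < r" "b < s" "g i a = g j b"
    then have "i = j" using adj[of i j a b] irreflE by metis
    then show "i = j \<and> a = b" using * g(1)[of i] by (auto dest: inj_onD)
  qed
  moreover have "(g 0 0, g 0 1) \<in> E" using g(3)[of 0] assms by auto
  ultimately show ?thesis unfolding contains_plus_def using adj
    by (intro exI[of _ "\<lambda>(i, a). g i a"]) auto
qed

text \<open>Adding \<open>w\<close> to part 0 keeps the parts completely joined, and the edge from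
  \<open>w\<close> to any vertex of \<open>P 0\<close> serves as the extra edge.\<close>

lemma contains_plus_vertexI:
  assumes P: "\<And>i. i < r \<Longrightarrow> finite (P i) \<and> s \<le> card (P i) \<and> P i \<subseteq> nbrs E w"
    and compl: "\<And>i j. i < r \<Longrightarrow> j < r \<Longrightarrow> i \<noteq> j \<Longrightarrow> P i \<times> P j \<subseteq> E"
    and "0 < r" "s \<ge> 2"
  shows "contains_plus E r s"
proof -
  have "P 0 \<noteq> {}" using P[OF \<open>0 < r\<close>] \<open>s \<ge> 2\<close> by (intro notI) simp
  then obtain b where b: "b \<in> P 0" by auto
  show ?thesis
  proof (rule contains_plusI[of r "\<lambda>i. if i = 0 then insert w (P 0) else P i" s 0 w b])
    show "finite (if i = 0 then insert w (P 0) else P i) \<and>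
        s \<le> card (if i = 0 then insert w (P 0) else P i)" if "i < r" for i
      using P[OF that] by (auto simp: card_insert_if)
    show "(if i = 0 then insert w (P 0) else P i) \<times> (if j = 0 then insert w (P 0) else P j) \<subseteq> E"
      if "i < r" "j < r" "i \<noteq> j" for i j
      using compl[OF that] P[OF that(1)] P[OF that(2)] that
      by (auto simp: mem_nbrs symE subset_iff)
    show "(w, b) \<in> E" using P[OF \<open>0 < r\<close>] b by (auto simp: mem_nbrs)
  qed (use b assms in auto)
qed

section \<open>Greedy construction of complete multipartite subgraphs\<close>

lemma sum_card_nonneighbours_swap:
  assumes "finite A" "finite B"
  shows "(\<Sum>w\<in>B. card (A - nbrs E w)) = (\<Sum>a\<in>A. card (B - nbrs E a))"
proof -
  have count: "card (C - nbrs E v) = (\<Sum>a\<in>C. if (v, a) \<in> E then 0 else 1)" if "finite C" for C v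
  proof -
    have "C \<inter> - {a. (v, a) \<in> E} = C - nbrs E v" by (auto simp: nbrs_def)
    then show ?thesis using that by (simp add: sum.If_cases)
  qed
  have "(\<Sum>w\<in>B. card (A - nbrs E w)) = (\<Sum>w\<in>B. \<Sum>a\<in>A. if (w, a) \<in> E then 0 else 1)"
    using assms count by simp
  also have "\<dots> = (\<Sum>a\<in>A. \<Sum>w\<in>B. if (w, a) \<in> E then 0 else 1)" by (rule sum.swap)
  also have "\<dots> = (\<Sum>a\<in>A. \<Sum>w\<in>B. if (a, w) \<in> E then 0 else 1)"
    using symE by (intro sum.cong refl) metis
  also have "\<dots> = (\<Sum>a\<in>A. card (B - nbrs E a))"
    using assms count by simp
  finally show ?thesis .
qed

text \<open>Markov's inequality: a poorly joined \<open>w\<close> misses more than the fraction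
  \<open>1 - 1 / (2 r)\<close> of \<open>A\<close>, while by double counting the average miss is at
  most \<open>1 / r + 1 / (4 r^2)\<close> of \<open>A\<close>. The quotient of the two is
  \<open>(4 r + 1) / (2 r (2 r - 1))\<close>.\<close>

lemma card_poorly_joined:
  fixes T :: nat
  assumes fin: "finite A" "finite B" and "card A = T" "T > 0" "r \<ge> 1"
    and miss: "\<And>a. a \<in> A \<Longrightarrow> real (card (B - nbrs E a)) \<le> (1 / r + 1 / (4 * real r ^ 2)) * card B"
  shows "real (card {w \<in> B. 2 * r * card (A \<inter> nbrs E w) < T}) * ((2 * real r - 1) * (2 * r))
    \<le> (4 * real r + 1) * card B"
proof -
  let ?bad = "{w \<in> B. 2 * r * card (A \<inter> nbrs E w) < T}"
  have split: "card (A - nbrs E w) + card (A \<inter> nbrs E w) = T" for w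
    using fin card_Int_Diff[of A "nbrs E w"] assms by auto
  have bad: "(2 * real r - 1) * T \<le> 2 * r * real (card (A - nbrs E w))" if "w \<in> ?bad" for w
  proof -
    have "2 * r * card (A \<inter> nbrs E w) \<le> T" using that by simp
    then have "real (2 * r * card (A \<inter> nbrs E w)) \<le> T" by (simp only: of_nat_le_iff)
    moreover have "real (card (A \<inter> nbrs E w)) = T - real (card (A - nbrs E w))"
      using split[of w] by linarith
    ultimately show ?thesis by (simp add: algebra_simps)
  qed
  have "real (card ?bad) * ((2 * real r - 1) * T) \<le> (\<Sum>w\<in>?bad. 2 * r * real (card (A - nbrs E w)))"
    using sum_bounded_below[of ?bad "(2 * real r - 1) * T"] bad by auto
  also have "\<dots> \<le> (\<Sum>w\<in>B. 2 * r * real (card (A - nbrs E w)))"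
    using fin by (intro sum_mono2) auto
  also have "\<dots> = 2 * r * (\<Sum>w\<in>B. real (card (A - nbrs E w)))" by (simp add: sum_distrib_left)
  also have "\<dots> = 2 * r * (\<Sum>a\<in>A. real (card (B - nbrs E a)))"
    using sum_card_nonneighbours_swap[OF fin] by (metis of_nat_sum)
  also have "\<dots> \<le> 2 * r * (T * ((1 / r + 1 / (4 * real r ^ 2)) * card B))"
    using sum_bounded_above[of A "\<lambda>a. real (card (B - nbrs E a))"] miss assms by simp
  finally have "T * (real (card ?bad) * (2 * real r - 1)) \<le> T * (2 * r * ((1 / r + 1 / (4 * real r ^ 2)) * card B))"
    by (simp add: mult_ac)
  then have "real (card ?bad) * (2 * real r - 1) \<le> 2 * r * ((1 / r + 1 / (4 * real r ^ 2)) * card B)"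
    using \<open>T > 0\<close> by simp
  then have "real (card ?bad) * (2 * real r - 1) * (2 * r) \<le> 2 * r * ((1 / r + 1 / (4 * real r ^ 2)) * card B) * (2 * r)"
    by (rule mult_right_mono) simp
  also have "\<dots> = (4 * real r + 1) * card B" using \<open>r \<ge> 1\<close> by (simp add: field_simps power2_eq_square)
  finally show ?thesis by (simp add: algebra_simps)
qed

text \<open>
  At least \<open>1 / (4 r)\<close> of the vertices of \<open>B\<close> have \<open>T'\<close> neighbours in each \<open>A i\<close>; at least
  \<open>2 ^ N\<close> of these have the same trace on the union of the \<open>A i\<close>.
\<close>

lemma ex_complete_multipartite_step:
  fixes A :: "nat \<Rightarrow> 'a set"
  assumes "k < r" "finite B" "T' > 0"
    and A: "\<And>i. i < k \<Longrightarrow> finite (A i) \<and> card (A i) = 2 * r * T'"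
    and compl: "\<And>i j. i < k \<Longrightarrow> j < k \<Longrightarrow> i \<noteq> j \<Longrightarrow> A i \<times> A j \<subseteq> E"
    and miss: "\<And>i a. i < k \<Longrightarrow> a \<in> A i \<Longrightarrow>
      real (card (B - nbrs E a)) \<le> (1 / r + 1 / (4 * real r ^ 2)) * card B"
    and "T' \<le> N" "k * (2 * r * T') \<le> N" "4 * r * 4 ^ N \<le> card B"
  shows "\<exists>A'. (\<forall>i<k. A' i \<subseteq> A i) \<and> A' k \<subseteq> B \<and> (\<forall>i\<le>k. card (A' i) = T') \<and>
    (\<forall>i\<le>k. \<forall>j\<le>k. i \<noteq> j \<longrightarrow> A' i \<times> A' j \<subseteq> E)"
proof -
  define bad where "bad i = {w \<in> B. 2 * r * card (A i \<inter> nbrs E w) < 2 * r * T'}" for i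
  define good where "good = B - (\<Union>i<k. bad i)"
  define R where "R = real r"
  define b where "b = real (card B)"
  have R: "R \<ge> 1" using assms by (simp add: R_def)
  have "real (card (bad i)) * ((2 * R - 1) * (2 * R)) \<le> (4 * R + 1) * b" if "i < k" for i
    unfolding bad_def R_def b_def
    by (rule card_poorly_joined) (use assms that miss in auto)
  then have "(\<Sum>i<k. real (card (bad i)) * ((2 * R - 1) * (2 * R))) \<le> k * ((4 * R + 1) * b)"
    using sum_bounded_above[of "{..<k}" "\<lambda>i. real (card (bad i)) * ((2 * R - 1) * (2 * R))"] by simp
  moreover have "real (card (\<Union>i<k. bad i)) \<le> (\<Sum>i<k. real (card (bad i)))"
    using card_UN_le[of "{..<k}" bad] by (metis finite_lessThan of_nat_le_iff of_nat_sum)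
  then have "real (card (\<Union>i<k. bad i)) * ((2 * R - 1) * (2 * R)) \<le> (\<Sum>i<k. real (card (bad i))) * ((2 * R - 1) * (2 * R))"
    using R by (intro mult_right_mono) auto
  moreover have "k * ((4 * R + 1) * b) \<le> (R - 1) * ((4 * R + 1) * b)"
    using \<open>k < r\<close> R by (intro mult_right_mono) (auto simp: R_def b_def)
  ultimately have "real (card (\<Union>i<k. bad i)) * ((2 * R - 1) * (2 * R)) \<le> (R - 1) * ((4 * R + 1) * b)"
    by (simp add: sum_distrib_right)
  moreover have "real (card good) = b - real (card (\<Union>i<k. bad i))"
  proof -
    have sub: "(\<Union>i<k. bad i) \<subseteq> B" by (auto simp: bad_def)
    then show ?thesis unfolding good_def b_def
      using \<open>finite B\<close> card_mono[OF _ sub] by (subst card_Diff_subset) (auto intro: finite_subset)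
  qed
  then have "real (card (\<Union>i<k. bad i)) = b - real (card good)" by simp
  ultimately have "(b - real (card good)) * ((2 * R - 1) * (2 * R)) \<le> (R - 1) * ((4 * R + 1) * b)"
    by (simp only:)
  \<comment> \<open>At most \<open>R - 1\<close> bad sets, each of proportion at most
    \<open>(4 R + 1) / (2 R (2 R - 1))\<close>, leave the proportion
    \<open>(R + 1) / (2 R (2 R - 1))\<close> good; this is then weakened to
    \<open>1 / (4 R)\<close>.\<close>
  then have "(R + 1) * b \<le> real (card good) * ((2 * R - 1) * (2 * R))"
    by (simp add: algebra_simps)
  also have "\<dots> \<le> real (card good) * (4 * R * (R + 1))"
    using R by (intro mult_left_mono) (auto simp: algebra_simps)
  finally have "(R + 1) * b \<le> (R + 1) * (4 * R * card good)" by (simp add: algebra_simps)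
  then have "b \<le> 4 * R * card good" using R by simp
  then have good: "card B \<le> 4 * r * card good" unfolding b_def R_def
    by (metis of_nat_le_iff of_nat_mult of_nat_numeral)
  then have "4 * r * 4 ^ N \<le> 4 * r * card good" using assms by linarith
  then have good4: "4 ^ N \<le> card good" using assms by simp
  define U where "U = (\<Union>i<k. A i)"
  have finU: "finite U" using A by (auto simp: U_def)
  have cardU: "card U \<le> N"
  proof -
    have "card U \<le> (\<Sum>i<k. card (A i))" unfolding U_def by (rule card_UN_le) simp
    also have "\<dots> = k * (2 * r * T')" using A by simp
    finally show ?thesis using assms by linarith
  qed
  have fing: "finite good" using \<open>finite B\<close> by (simp add: good_def)
  have "card good = (\<Sum>S\<in>Pow U. card {w \<in> good. U \<inter> nbrs E w = S})"
    using card_eq_sum sum.group[of good "Pow U" "\<lambda>w. U \<inter> nbrs E w" "\<lambda>_. 1::nat"] fing finU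
    by (simp add: image_subset_iff)
  \<comment> \<open>\<open>U\<close> has at most \<open>N\<close> vertices and thus at most
    \<open>2 ^ N\<close> subsets, against at least \<open>4 ^ N\<close> good vertices.\<close>
  obtain S where S: "S \<in> Pow U" "2 ^ N \<le> card {w \<in> good. U \<inter> nbrs E w = S}"
  proof (rule ccontr)
    assume "\<not> thesis"
    then have "\<And>S. S \<in> Pow U \<Longrightarrow> card {w \<in> good. U \<inter> nbrs E w = S} \<le> 2 ^ N - 1"
      using that by (metis Suc_pred' less_Suc_eq_le linorder_not_le pos2 zero_less_power)
    then have "(\<Sum>S\<in>Pow U. card {w \<in> good. U \<inter> nbrs E w = S}) \<le> card (Pow U) * (2 ^ N - 1)"
      using sum_bounded_above[of "Pow U"] by (metis (no_types, lifting) of_nat_id)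
    also have "\<dots> \<le> 2 ^ N * (2 ^ N - 1)"
      using cardU finU by (intro mult_right_mono) (auto simp: card_Pow)
    also have "\<dots> < 2 ^ N * 2 ^ N" by simp
    also have "\<dots> = 4 ^ N" by (simp flip: power_mult_distrib)
    finally show False using good4 \<open>card good = _\<close> by linarith
  qed
  define F where "F = {w \<in> good. U \<inter> nbrs E w = S}"
  have "T' < 2 ^ N" using \<open>T' \<le> N\<close> less_exp[of N] by linarith
  then have F: "T' \<le> card F" using S by (simp add: F_def)
  have "F \<noteq> {}" using F \<open>T' > 0\<close> by auto
  then obtain w0 where w0: "w0 \<in> F" by auto
  have AS: "T' \<le> card (A i \<inter> S)" if "i < k" for i
  proof -
    have "w0 \<notin> bad i" "w0 \<in> B" using w0 that by (auto simp: F_def good_def)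
    then have "2 * r * T' \<le> 2 * r * card (A i \<inter> nbrs E w0)" by (auto simp: bad_def)
    then have "T' \<le> card (A i \<inter> nbrs E w0)" using \<open>k < r\<close> by simp
    moreover have "A i \<inter> nbrs E w0 = A i \<inter> S" using w0 that by (auto simp: F_def U_def)
    ultimately show ?thesis by simp
  qed
  have "\<exists>C. C \<subseteq> (if i < k then A i \<inter> S else F) \<and> card C = T'" for i
    using obtain_subset_with_card_n[of T' "if i < k then A i \<inter> S else F"] AS F by (metis (full_types))
  then obtain A' where A': "\<And>i. A' i \<subseteq> (if i < k then A i \<inter> S else F)" "\<And>i. card (A' i) = T'"
    by metis
  have SF: "(a, w) \<in> E \<and> (w, a) \<in> E" if "a \<in> S" "w \<in> F" for a w
    using that symE by (auto simp: F_def nbrs_def)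
  have "A' i \<times> A' j \<subseteq> E" if "i \<le> k" "j \<le> k" "i \<noteq> j" for i j
  proof (cases "i < k \<and> j < k")
    case True
    then show ?thesis using compl[of i j] A'(1)[of i] A'(1)[of j] that by auto
  next
    case False
    then show ?thesis using SF A'(1)[of i] A'(1)[of j] that by (cases "i < k"; cases "j < k"; force)
  qed
  moreover have "A' k \<subseteq> B" using A'(1)[of k] by (auto simp: F_def good_def)
  moreover have "A' i \<subseteq> A i" if "i < k" for i using A'(1)[of i] that by auto
  ultimately show ?thesis using A'(2) by (intro exI[of _ A']) blast
qed

text \<open>Parts are added one at a time. Each step shrinks the earlier parts by the factor
  \<open>2 * r\<close>, so after \<open>k\<close> steps they have size
  \<open>s * (2 * r) ^ (r - k)\<close>, ending at \<open>s\<close>. The host sets \<open>X i\<close>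
  may differ, since the lemma is applied both to the whole vertex set and to subsets of the
  clusters.\<close>

lemma ex_complete_multipartite:
  fixes X :: "nat \<Rightarrow> 'a set" and r s :: nat
  assumes "s > 0"
    and fin: "\<And>i. i < r \<Longrightarrow> finite (X i)"
    and miss: "\<And>i j v. i < r \<Longrightarrow> j < r \<Longrightarrow> i \<noteq> j \<Longrightarrow> v \<in> X i \<Longrightarrow>
      real (card (X j - nbrs E v)) \<le> (1 / r + 1 / (4 * real r ^ 2)) * card (X j)"
    and big: "\<And>i. i < r \<Longrightarrow> 4 * r * 4 ^ (r * s * (2 * r) ^ (r - 1)) \<le> card (X i)"
  shows "\<exists>A. (\<forall>i<r. A i \<subseteq> X i \<and> card (A i) = s) \<and>
    (\<forall>i<r. \<forall>j<r. i \<noteq> j \<longrightarrow> A i \<times> A j \<subseteq> E)"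
proof -
  have "\<exists>A. (\<forall>i<k. A i \<subseteq> X i \<and> card (A i) = s * (2 * r) ^ (r - k)) \<and>
    (\<forall>i<k. \<forall>j<k. i \<noteq> j \<longrightarrow> A i \<times> A j \<subseteq> E)" if "k \<le> r" for k
    using that
  proof (induction k)
    case 0
    then show ?case by simp
  next
    case (Suc k)
    define T where "T = s * (2 * r) ^ (r - Suc k)"
    have eq: "s * (2 * r) ^ (r - k) = 2 * r * T"
    proof -
      have "r - k = Suc (r - Suc k)" using Suc.prems by auto
      then show ?thesis by (simp add: T_def)
    qed
    have "\<exists>A. (\<forall>i<k. A i \<subseteq> X i \<and> card (A i) = 2 * r * T) \<and>
        (\<forall>i<k. \<forall>j<k. i \<noteq> j \<longrightarrow> A i \<times> A j \<subseteq> E)"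
      using Suc.IH[OF Suc_leD[OF Suc.prems]] unfolding eq .
    then obtain A where "\<forall>i<k. A i \<subseteq> X i \<and> card (A i) = 2 * r * T"
      "\<forall>i<k. \<forall>j<k. i \<noteq> j \<longrightarrow> A i \<times> A j \<subseteq> E"
      by (elim exE conjE)
    then have A: "\<And>i. i < k \<Longrightarrow> A i \<subseteq> X i \<and> card (A i) = 2 * r * T"
      "\<And>i j. i < k \<Longrightarrow> j < k \<Longrightarrow> i \<noteq> j \<Longrightarrow> A i \<times> A j \<subseteq> E"
      by simp_all
    have r: "r \<ge> 1" using Suc.prems by simp
    have "T > 0" using \<open>s > 0\<close> r by (simp add: T_def)
    have mono: "(2 * r) ^ a \<le> (2 * r) ^ (r - 1)" if "a \<le> r - 1" for a
      using that r by (intro power_increasing) auto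
    have 1: "T \<le> r * s * (2 * r) ^ (r - 1)"
    proof -
      have "T \<le> s * (2 * r) ^ (r - 1)" unfolding T_def using mono by (intro mult_left_mono) auto
      also have "\<dots> \<le> r * (s * (2 * r) ^ (r - 1))" using r by simp
      finally show ?thesis by (simp add: mult_ac)
    qed
    \<comment> \<open>For \<open>k = 0\<close> the size carries the exponent \<open>r\<close>,
      beyond the bound \<open>r - 1\<close>, but there are no parts yet.\<close>
    have 2: "k * (2 * r * T) \<le> r * s * (2 * r) ^ (r - 1)"
    proof (cases "k = 0")
      case False
      then have "k * (2 * r * T) \<le> r * (s * (2 * r) ^ (r - 1))" unfolding eq[symmetric]
        using Suc.prems mono[of "r - k"] by (intro mult_mono) auto
      then show ?thesis by (simp add: mult_ac)
    qed simp
    have "\<exists>A'. (\<forall>i<k. A' i \<subseteq> A i) \<and> A' k \<subseteq> X k \<and> (\<forall>i\<le>k. card (A' i) = T) \<and>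
      (\<forall>i\<le>k. \<forall>j\<le>k. i \<noteq> j \<longrightarrow> A' i \<times> A' j \<subseteq> E)"
    proof (rule ex_complete_multipartite_step[OF _ _ \<open>T > 0\<close> _ _ _ 1 2])
      show "k < r" "finite (X k)" using Suc.prems fin by auto
      show "finite (A i) \<and> card (A i) = 2 * r * T" if "i < k" for i
        using A(1)[OF that] fin[of i] that Suc.prems by (auto intro: finite_subset)
      show "real (card (X k - nbrs E a)) \<le> (1 / real r + 1 / (4 * (real r)\<^sup>2)) * real (card (X k))"
        if "i < k" "a \<in> A i" for i a
        using miss[of i k a] A(1)[of i] that Suc.prems by auto
      show "4 * r * 4 ^ (r * s * (2 * r) ^ (r - 1)) \<le> card (X k)" using big Suc.prems by auto
    qed (use A in auto)
    then obtain A' where A': "\<And>i. i < k \<Longrightarrow> A' i \<subseteq> A i" "A' k \<subseteq> X k"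
      "\<And>i. i \<le> k \<Longrightarrow> card (A' i) = T"
      "\<And>i j. i \<le> k \<Longrightarrow> j \<le> k \<Longrightarrow> i \<noteq> j \<Longrightarrow> A' i \<times> A' j \<subseteq> E"
      by blast
    have "A' i \<subseteq> X i" if "i \<le> k" for i
      using A'(1)[of i] A'(2) A(1)[of i] that by (cases "i = k") auto
    then show ?case using A' by (intro exI[of _ A']) (auto simp: T_def less_Suc_eq_le)
  qed
  from this[of r] show ?thesis by simp
qed

section \<open>Dense graphs without the target graph are multipartite\<close>

text \<open>A vertex joins cluster \<open>i\<close> if it has fewer than \<open>s\<close> neighbours
  in \<open>A i\<close> and misses at most \<open>q\<close> vertices of every other
  \<open>A j\<close>. An unclassified vertex misses about \<open>q\<close> vertices more than the
  minimum \<open>t - s\<close>, so comparison with the average shows that there are few of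
  them.\<close>

lemma ex_independent_clusters:
  fixes V :: "'a set" and r s :: nat
  assumes "r \<ge> 2" "s \<ge> 2" "finite V"
    and deg: "\<And>v. v \<in> V \<Longrightarrow> real (card (V - nbrs E v)) \<le> (1 / r + 1 / (80 * real r ^ 3)) * card V"
    and big: "4 * r * 4 ^ (r * (64 * r\<^sup>2 * s) * (2 * r) ^ (r - 1)) \<le> card V"
    and free: "\<not> contains_plus E r s"
  shows "\<exists>W. (\<forall>i<r. W i \<subseteq> V \<and> (\<forall>u\<in>W i. \<forall>w\<in>W i. (u, w) \<notin> E)) \<and>
    (\<forall>i<r. \<forall>j<r. i \<noteq> j \<longrightarrow> W i \<inter> W j = {}) \<and>
    real (card (V - (\<Union>i<r. W i))) \<le> (1 / 20 + 1 / 16) / real r ^ 2 * card V"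
proof -
  define t where "t = 64 * r\<^sup>2 * s"
  define q where "q = 16 * r\<^sup>2 * s"
  define R where "R = real r"
  define M where "M = real (card V)"
  have R: "R \<ge> 2" using assms by (simp add: R_def)
  \<comment> \<open>With \<open>q\<close> a quarter of \<open>t\<close>, two vertices that each miss
    at most \<open>q\<close> of \<open>A j\<close> share at least \<open>2 * q \<ge> s\<close>
    neighbours there.\<close>
  have t: "t = 4 * q" by (simp add: t_def q_def)
  have "1 \<le> r\<^sup>2" using assms by simp
  then have sq: "16 * s \<le> q" unfolding q_def by simp
  have "\<exists>A. (\<forall>i<r. A i \<subseteq> V \<and> card (A i) = t) \<and> (\<forall>i<r. \<forall>j<r. i \<noteq> j \<longrightarrow> A i \<times> A j \<subseteq> E)"
  proof (rule ex_complete_multipartite[where X = "\<lambda>_. V"])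
    show "t > 0" using assms by (simp add: t_def)
    show "real (card (V - nbrs E v)) \<le> (1 / real r + 1 / (4 * (real r)\<^sup>2)) * real (card V)"
      if "v \<in> V" for v
    proof -
      have "1 / (80 * R ^ 3) \<le> 1 / (4 * R ^ 2)"
        using R by (simp add: field_simps power2_eq_square power3_eq_cube)
      then have "(1 / R + 1 / (80 * R ^ 3)) * M \<le> (1 / R + 1 / (4 * R ^ 2)) * M"
        by (intro mult_right_mono) (auto simp: M_def)
      then show ?thesis using deg[OF that] by (simp add: R_def M_def)
    qed
  qed (use assms big in \<open>auto simp: t_def\<close>)
  then obtain A where "\<forall>i<r. A i \<subseteq> V \<and> card (A i) = t"
    "\<forall>i<r. \<forall>j<r. i \<noteq> j \<longrightarrow> A i \<times> A j \<subseteq> E"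
    by (elim exE conjE)
  then have A: "\<And>i. i < r \<Longrightarrow> A i \<subseteq> V \<and> card (A i) = t"
    and compl: "\<And>i j. i < r \<Longrightarrow> j < r \<Longrightarrow> i \<noteq> j \<Longrightarrow> A i \<times> A j \<subseteq> E"
    by simp_all
  have finA: "finite (A i)" if "i < r" for i using A[OF that] \<open>finite V\<close> finite_subset by blast
  have split: "card (A i - nbrs E w) + card (A i \<inter> nbrs E w) = t" if "i < r" for i w
    using card_Int_Diff[OF finA[OF that], of "nbrs E w"] A[OF that] by simp
  have poor: "\<exists>i<r. card (A i \<inter> nbrs E w) < s" for w
  proof (rule ccontr)
    assume *: "\<not> ?thesis"
    have "contains_plus E r s"
    proof (rule contains_plus_vertexI[of r "\<lambda>i. A i \<inter> nbrs E w" s w])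
      show "finite (A i \<inter> nbrs E w) \<and> s \<le> card (A i \<inter> nbrs E w) \<and> A i \<inter> nbrs E w \<subseteq> nbrs E w"
        if "i < r" for i using finA[OF that] * that by auto
      show "(A i \<inter> nbrs E w) \<times> (A j \<inter> nbrs E w) \<subseteq> E" if "i < r" "j < r" "i \<noteq> j" for i j
        using compl[OF that] by blast
    qed (use assms in auto)
    then show False using free by simp
  qed
  define W where "W i = {w \<in> V. card (A i \<inter> nbrs E w) < s \<and>
    (\<forall>j<r. j \<noteq> i \<longrightarrow> card (A j - nbrs E w) \<le> q)}" for i
  have indep: "(u, w) \<notin> E" if "i < r" "u \<in> W i" "w \<in> W i" for i u w
  proof
    assume uw: "(u, w) \<in> E"
    \<comment> \<open>The edge is added to \<open>A i\<close>; the other parts are the common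
      neighbours of its ends in the \<open>A j\<close>.\<close>
    define P where "P j = (if j = i then insert u (insert w (A i)) else A j \<inter> nbrs E u \<inter> nbrs E w)" for j
    have "contains_plus E r s"
    proof (rule contains_plusI[of r P s i u w])
      show "finite (P j) \<and> s \<le> card (P j)" if "j < r" for j
      proof (cases "j = i")
        case True
        have "card (A i) \<le> card (insert u (insert w (A i)))"
          using finA[OF \<open>i < r\<close>] by (intro card_mono) auto
        then show ?thesis using True A[OF \<open>i < r\<close>] finA[OF \<open>i < r\<close>] sq t by (simp add: P_def)
      next
        case False
        have "card (A j) \<le> card ((A j - nbrs E u) \<union> (A j - nbrs E w) \<union> (A j \<inter> nbrs E u \<inter> nbrs E w))"
          using finA[OF that] by (intro card_mono) auto
        also have "\<dots> \<le> card (A j - nbrs E u) + card (A j - nbrs E w) + card (A j \<inter> nbrs E u \<inter> nbrs E w)"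
          by (meson add_mono card_Un_le le_trans order_refl)
        finally have "t \<le> q + q + card (A j \<inter> nbrs E u \<inter> nbrs E w)"
          using A[OF that] \<open>u \<in> W i\<close> \<open>w \<in> W i\<close> False that by (force simp: W_def)
        then show ?thesis using False finA[OF that] sq t by (simp add: P_def)
      qed
      show "P j \<times> P k \<subseteq> E" if "j < r" "k < r" "j \<noteq> k" for j k
        using compl[OF that] that by (auto simp: P_def mem_nbrs symE)
    qed (use assms that uw in \<open>auto simp: P_def\<close>)
    then show False using free by simp
  qed
  have disj: "W i \<inter> W j = {}" if "i < r" "j < r" "i \<noteq> j" for i j
  proof (rule ccontr)
    assume "W i \<inter> W j \<noteq> {}"
    then obtain w where "w \<in> W i" "w \<in> W j" by auto
    then have "card (A i \<inter> nbrs E w) < s" "card (A i - nbrs E w) \<le> q"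
      using that by (auto simp: W_def)
    then show False using split[OF that(1), of w] t sq by linarith
  qed
  \<comment> \<open>Every vertex misses at least \<open>t - s\<close> vertices of the union of the \<open>A i\<close>, and the average number of
    misses is hardly larger.\<close>
  define ms where "ms w = (\<Sum>i<r. card (A i - nbrs E w))" for w
  have ms_ge: "t \<le> ms w + s" for w
  proof -
    obtain i where i: "i < r" "card (A i \<inter> nbrs E w) < s" using poor by blast
    have "card (A i - nbrs E w) \<le> ms w" unfolding ms_def using i by (intro member_le_sum) auto
    then show ?thesis using split[OF i(1), of w] i(2) by linarith
  qed
  \<comment> \<open>Such a vertex misses more than \<open>t - s\<close> of one \<open>A i\<close>,
    and failing the second condition of \<open>W i\<close> it also misses more than \<open>q\<close>
    of another \<open>A j\<close>.\<close>
  have X_large: "t - s + q < ms w" if "w \<in> V - (\<Union>i<r. W i)" for w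
  proof (rule ccontr)
    assume le: "\<not> ?thesis"
    obtain i where i: "i < r" "card (A i \<inter> nbrs E w) < s" using poor by blast
    have "w \<notin> W i" using that i by auto
    moreover have "w \<in> V" using that by simp
    ultimately obtain j where j: "j < r" "j \<noteq> i" "q < card (A j - nbrs E w)"
      using i by (auto simp: W_def not_le)
    have "card (A i - nbrs E w) + card (A j - nbrs E w) = (\<Sum>k\<in>{i, j}. card (A k - nbrs E w))"
      using j by simp
    also have "\<dots> \<le> ms w" unfolding ms_def using i j by (intro sum_mono2) auto
    finally show False using le split[OF i(1), of w] i(2) j(3) by linarith
  qed
  have total: "real (\<Sum>w\<in>V. ms w) \<le> t * ((1 + 1 / (80 * R ^ 2)) * M)"
  proof -
    have "(\<Sum>w\<in>V. ms w) = (\<Sum>i<r. \<Sum>w\<in>V. card (A i - nbrs E w))" unfolding ms_def by (rule sum.swap)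
    also have "\<dots> = (\<Sum>i<r. \<Sum>a\<in>A i. card (V - nbrs E a))"
      by (rule sum.cong) (simp_all add: sum_card_nonneighbours_swap finA \<open>finite V\<close>)
    finally have "real (\<Sum>w\<in>V. ms w) = (\<Sum>i<r. \<Sum>a\<in>A i. real (card (V - nbrs E a)))" by simp
    also have "\<dots> \<le> (\<Sum>i<r. t * ((1 / R + 1 / (80 * R ^ 3)) * M))"
    proof (rule sum_mono)
      fix i assume "i \<in> {..<r}"
      then have i: "i < r" by simp
      have "(\<Sum>a\<in>A i. real (card (V - nbrs E a))) \<le> card (A i) * ((1 / R + 1 / (80 * R ^ 3)) * M)"
        using sum_bounded_above[of "A i" "\<lambda>a. real (card (V - nbrs E a))"] deg A[OF i]
        by (force simp: R_def M_def)
      then show "(\<Sum>a\<in>A i. real (card (V - nbrs E a))) \<le> t * ((1 / R + 1 / (80 * R ^ 3)) * M)"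
        using A[OF i] by simp
    qed
    also have "\<dots> = R * (t * ((1 / R + 1 / (80 * R ^ 3)) * M))" by (simp add: R_def)
    also have "\<dots> = t * ((1 + 1 / (80 * R ^ 2)) * M)"
      using R by (simp add: field_simps power2_eq_square power3_eq_cube)
    finally show ?thesis .
  qed
  define X where "X = V - (\<Union>i<r. W i)"
  have tpos: "t > 0" "s \<le> t" using sq t assms by auto
  have "real (card X) * q + M * (real t - s) \<le> (\<Sum>w\<in>V. real (ms w))"
  proof -
    have XV: "X \<subseteq> V" by (auto simp: X_def)
    have "real (card X) * q + M * (real t - s) = (\<Sum>w\<in>V. (if w \<in> X then real q else 0) + (real t - s))"
      using \<open>finite V\<close> XV by (simp add: sum.distrib M_def sum.If_cases Int_absorb1 flip: Int_def)
    also have "\<dots> \<le> (\<Sum>w\<in>V. real (ms w))"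
    proof (rule sum_mono)
      fix w assume "w \<in> V"
      show "(if w \<in> X then real q else 0) + (real t - s) \<le> real (ms w)"
        using X_large[of w] ms_ge[of w] tpos by (auto simp: X_def[symmetric])
    qed
    finally show ?thesis .
  qed
  then have "real (card X) * q \<le> t * ((1 + 1 / (80 * R ^ 2)) * M) - M * (real t - s)"
    using total by simp
  \<comment> \<open>The excess per vertex is \<open>t / (80 R^2) + s\<close>; here
    \<open>t = 4 * q\<close> yields \<open>1 / 20\<close> and \<open>s = q / (16 R^2)\<close> yields
    \<open>1 / 16\<close>.\<close>
  also have "\<dots> = q * ((1 / 20 + 1 / 16) / R ^ 2 * M)"
    using R by (simp add: t_def q_def R_def field_simps)
  finally have "real q * card X \<le> real q * ((1 / 20 + 1 / 16) / R ^ 2 * M)"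
    by (simp only: mult.commute)
  then have "card X \<le> (1 / 20 + 1 / 16) / R ^ 2 * M"
    by (rule mult_left_le_imp_le) (use tpos t in simp)
  then show ?thesis
    using indep disj by (intro exI[of _ W]) (auto simp: X_def R_def M_def W_def)
qed

text \<open>Each vertex has fewer than \<open>l\<close> neighbours in some cluster, which becomes
  its class. Missing almost all of that cluster nearly exhausts its allowance \<open>a\<close> of
  non-neighbours, so it is joined to almost all of the others. Two adjacent vertices of one class
  would then have enough common neighbours to produce the forbidden graph.\<close>

lemma multipartite_of_clusters:
  fixes V :: "'a set" and r s :: nat
  assumes "r \<ge> 2" "s \<ge> 2" "finite V"
    and deg: "\<And>v. v \<in> V \<Longrightarrow> real (card (V - nbrs E v)) \<le> (1 / r + 1 / (80 * real r ^ 3)) * card V"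
    and big: "32 * r\<^sup>2 * 4 ^ (r * s * (2 * r) ^ (r - 1)) \<le> card V"
    and free: "\<not> contains_plus E r s"
    and WV: "\<And>i. i < r \<Longrightarrow> W i \<subseteq> V"
    and indep: "\<And>i u w. i < r \<Longrightarrow> u \<in> W i \<Longrightarrow> w \<in> W i \<Longrightarrow> (u, w) \<notin> E"
    and disj: "\<And>i j. i < r \<Longrightarrow> j < r \<Longrightarrow> i \<noteq> j \<Longrightarrow> W i \<inter> W j = {}"
    and rest: "real (card (V - (\<Union>i<r. W i))) \<le> (1 / 20 + 1 / 16) / real r ^ 2 * card V"
  shows "\<exists>p. \<forall>v\<in>V. p v < r \<and> (\<forall>u\<in>V. (u, v) \<in> E \<longrightarrow> p u \<noteq> p v)"
proof -
  define R where "R = real r"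
  define M where "M = real (card V)"
  \<comment> \<open>\<open>a\<close> bounds the non-neighbours of any vertex, \<open>z\<close> the
    deviation of cluster sizes from \<open>a\<close>, and \<open>l\<close> is a size at which
    subsets of clusters still contain the required complete multipartite graph. The argument rests
    on \<open>z \<le> l / R\<close> and \<open>8 * l \<le> a\<close>.\<close>
  define a where "a = (1 / R + 1 / (80 * R ^ 3)) * M"
  define z where "z = M / (8 * R ^ 2)"
  define l where "l = M / (8 * R)"
  have R: "R \<ge> 2" using assms by (simp add: R_def)
  have M0: "M \<ge> 0" by (simp add: M_def)
  have z_le: "z \<le> l / R" unfolding z_def l_def by (simp add: power2_eq_square)
  have z_le': "z \<le> l / 2"
  proof -
    have "l / R \<le> l / 2" using R M0 by (intro divide_left_mono) (auto simp: l_def)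
    with z_le show ?thesis by (rule order_trans)
  qed
  have a_ge: "8 * l \<le> a"
    using R M0 by (simp add: l_def a_def field_simps)
  have finW: "finite (W i)" if "i < r" for i using WV[OF that] \<open>finite V\<close> finite_subset by blast
  have W_le: "card (W i) \<le> a" if i: "i < r" for i
  proof (cases "W i = {}")
    case True
    then show ?thesis using M0 R by (simp add: a_def)
  next
    case False
    then obtain v where v: "v \<in> W i" by auto
    have "card (W i) \<le> card (V - nbrs E v)"
      using indep[OF i v] WV[OF i] \<open>finite V\<close> by (intro card_mono) (auto simp: mem_nbrs)
    then have "real (card (W i)) \<le> card (V - nbrs E v)" by simp
    also have "\<dots> \<le> a" using deg[of v] WV[OF i] v by (auto simp: a_def R_def M_def)
    finally show ?thesis .
  qed
  have W_ge: "a - z \<le> card (W i)" if i: "i < r" for i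
  proof -
    have "card V \<le> card (V - (\<Union>j<r. W j)) + card (\<Union>j<r. W j)"
      using card_mono[of "(V - (\<Union>j<r. W j)) \<union> (\<Union>j<r. W j)" V] finW \<open>finite V\<close>
        card_Un_le[of "V - (\<Union>j<r. W j)" "\<Union>j<r. W j"] by force
    moreover have "card (\<Union>j<r. W j) \<le> (\<Sum>j<r. card (W j))" by (rule card_UN_le) simp
    ultimately have "M \<le> card (V - (\<Union>j<r. W j)) + (\<Sum>j<r. real (card (W j)))"
      unfolding M_def of_nat_sum[symmetric] of_nat_add[symmetric] of_nat_le_iff by linarith
    also have "(\<Sum>j<r. real (card (W j))) = card (W i) + (\<Sum>j\<in>{..<r} - {i}. real (card (W j)))"
      using i by (simp add: sum.remove)
    also have "(\<Sum>j\<in>{..<r} - {i}. real (card (W j))) \<le> (R - 1) * a"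
      using sum_bounded_above[of "{..<r} - {i}" "\<lambda>j. real (card (W j))" a] W_le i
      by (simp add: R_def of_nat_diff)
    finally have "M - (1 / 20 + 1 / 16) / R ^ 2 * M - (R - 1) * a \<le> card (W i)"
      using rest by (simp add: R_def M_def)
    \<comment> \<open>Here \<open>R * a = M + M / (80 R^2)\<close>, and
      \<open>1/20 + 1/16 + 1/80 = 1/8\<close> is the constant of \<open>z\<close>.\<close>
    moreover have "M - (1 / 20 + 1 / 16) / R ^ 2 * M - (R - 1) * a = a - z"
      using R by (simp add: a_def z_def field_simps power2_eq_square power3_eq_cube)
    ultimately show ?thesis by simp
  qed
  \<comment> \<open>Clusters are disjoint, so the misses in \<open>W i\<close> and
    \<open>W j\<close> share the single allowance \<open>a\<close>.\<close>
  have miss_other: "card (W j - nbrs E v) \<le> a - card (W i - nbrs E v)"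
    if ij: "i < r" "j < r" "i \<noteq> j" and v: "v \<in> V" for i j v
  proof -
    have "card (W i - nbrs E v) + card (W j - nbrs E v) = card ((W i - nbrs E v) \<union> (W j - nbrs E v))"
      using finW[OF ij(1)] finW[OF ij(2)] disj[OF ij] by (intro card_Un_disjoint[symmetric]) auto
    also have "\<dots> \<le> card (V - nbrs E v)"
      using WV[OF ij(1)] WV[OF ij(2)] \<open>finite V\<close> by (intro card_mono) auto
    finally have "real (card (W i - nbrs E v)) + card (W j - nbrs E v) \<le> card (V - nbrs E v)"
      by (simp flip: of_nat_add)
    also have "\<dots> \<le> a" using deg[OF v] by (simp add: a_def R_def M_def)
    finally show ?thesis by simp
  qed
  \<comment> \<open>A vertex of \<open>W i\<close> misses all of \<open>W i\<close>, itself
    included, which uses up at least \<open>a - z\<close>.\<close>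
  have miss_W: "card (W j - nbrs E v) \<le> z" if ij: "i < r" "j < r" "i \<noteq> j" and v: "v \<in> W i" for i j v
  proof -
    have "W i - nbrs E v = W i" using indep[OF ij(1) v] by (auto simp: mem_nbrs)
    then show ?thesis using miss_other[OF ij, of v] W_ge[OF ij(1)] WV[OF ij(1)] v by auto
  qed
  \<comment> \<open>At most \<open>z \<le> l / R\<close> vertices of another cluster are missed,
    hence at most the fraction \<open>1 / R\<close> of any subset of it with at least
    \<open>l\<close> vertices.\<close>
  have find: "\<exists>A. (\<forall>i<r. A i \<subseteq> X i \<and> card (A i) = s) \<and> (\<forall>i<r. \<forall>j<r. i \<noteq> j \<longrightarrow> A i \<times> A j \<subseteq> E)"
    if X: "\<And>i. i < r \<Longrightarrow> X i \<subseteq> W i" "\<And>i. i < r \<Longrightarrow> l \<le> card (X i)" for X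
  proof (rule ex_complete_multipartite)
    show "s > 0" using assms by simp
    show fin: "finite (X i)" if "i < r" for i using X(1)[OF that] finW[OF that] finite_subset by blast
    show "real (card (X j - nbrs E v)) \<le> (1 / real r + 1 / (4 * (real r)\<^sup>2)) * real (card (X j))"
      if ij: "i < r" "j < r" "i \<noteq> j" and v: "v \<in> X i" for i j v
    proof -
      have "card (X j - nbrs E v) \<le> card (W j - nbrs E v)"
        using X(1)[OF ij(2)] finW[OF ij(2)] by (intro card_mono) auto
      then have "real (card (X j - nbrs E v)) \<le> card (W j - nbrs E v)" by simp
      also have "\<dots> \<le> z" using miss_W[OF ij] X(1)[OF ij(1)] v by auto
      also have "\<dots> \<le> l / R" by (rule z_le)
      also have "\<dots> \<le> 1 / R * card (X j)" using X(2)[OF ij(2)] R by (simp add: divide_right_mono)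
      also have "\<dots> \<le> (1 / R + 1 / (4 * R ^ 2)) * card (X j)"
        by (intro mult_right_mono) auto
      finally show ?thesis by (simp add: R_def)
    qed
    show "4 * r * 4 ^ (r * s * (2 * r) ^ (r - 1)) \<le> card (X i)" if "i < r" for i
    proof -
      have "real (32 * r\<^sup>2 * 4 ^ (r * s * (2 * r) ^ (r - 1))) \<le> M"
        unfolding M_def of_nat_le_iff by (rule big)
      then have "8 * R * real (4 * r * 4 ^ (r * s * (2 * r) ^ (r - 1))) \<le> 8 * R * l"
        using R by (simp add: l_def R_def power2_eq_square mult_ac)
      then have "real (4 * r * 4 ^ (r * s * (2 * r) ^ (r - 1))) \<le> l" using R
        by (metis mult_le_cancel_left_pos mult_pos_pos order_less_le_trans zero_less_numeral)
      then have "real (4 * r * 4 ^ (r * s * (2 * r) ^ (r - 1))) \<le> real (card (X i))"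
        using X(2)[OF that] by linarith
      then show ?thesis by (simp only: of_nat_le_iff)
    qed
  qed
  have "\<exists>i<r. card (W i \<inter> nbrs E w) < l" for w
  proof (rule ccontr)
    assume "\<not> ?thesis"
    then have *: "\<And>i. i < r \<Longrightarrow> l \<le> card (W i \<inter> nbrs E w)" by (meson not_less)
    have "\<exists>A. (\<forall>i<r. A i \<subseteq> W i \<inter> nbrs E w \<and> card (A i) = s) \<and> (\<forall>i<r. \<forall>j<r. i \<noteq> j \<longrightarrow> A i \<times> A j \<subseteq> E)"
      by (rule find) (use * in auto)
    then obtain A where "\<forall>i<r. A i \<subseteq> W i \<inter> nbrs E w \<and> card (A i) = s"
      "\<forall>i<r. \<forall>j<r. i \<noteq> j \<longrightarrow> A i \<times> A j \<subseteq> E"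
      by (elim exE conjE)
    then have A: "\<And>i. i < r \<Longrightarrow> A i \<subseteq> W i \<inter> nbrs E w \<and> card (A i) = s"
      "\<And>i j. i < r \<Longrightarrow> j < r \<Longrightarrow> i \<noteq> j \<Longrightarrow> A i \<times> A j \<subseteq> E"
      by simp_all
    have "contains_plus E r s"
    proof (rule contains_plus_vertexI[of r A s w])
      show "finite (A i) \<and> s \<le> card (A i) \<and> A i \<subseteq> nbrs E w" if "i < r" for i
        using A(1)[OF that] finW[OF that] by (auto intro: finite_subset)
    qed (use A(2) assms in auto)
    then show False using free by simp
  qed
  then obtain p where p: "\<And>w. p w < r" "\<And>w. card (W (p w) \<inter> nbrs E w) < l" by metis
  have miss_p: "card (W j - nbrs E w) \<le> z + l" if "j < r" "j \<noteq> p w" "w \<in> V" for j w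
  proof -
    have "card (W (p w) \<inter> nbrs E w) + card (W (p w) - nbrs E w) = card (W (p w))"
      using card_Int_Diff[OF finW[OF p(1)[of w]], of "nbrs E w"] by simp
    then have "real (card (W (p w) \<inter> nbrs E w)) + card (W (p w) - nbrs E w) = card (W (p w))"
      by (simp flip: of_nat_add)
    then show ?thesis using miss_other[of "p w" j w] that p[of w] W_ge[OF p(1)[of w]] by linarith
  qed
  have "p u \<noteq> p v" if u: "u \<in> V" and v: "v \<in> V" and uv: "(u, v) \<in> E" for u v
  proof
    assume eq: "p u = p v"
    define i where "i = p v"
    have i: "i < r" using p by (simp add: i_def)
    \<comment> \<open>For \<open>j \<noteq> i\<close> the common neighbourhood has at least
      \<open>a - z - 2 * (z + l) \<ge> l\<close> vertices, by \<open>a \<ge> 8 * l\<close> and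
      \<open>z \<le> l / 2\<close>.\<close>
    define X where "X j = (if j = i then W i else W j \<inter> nbrs E u \<inter> nbrs E v)" for j
    have "\<exists>A. (\<forall>j<r. A j \<subseteq> X j \<and> card (A j) = s) \<and> (\<forall>i<r. \<forall>j<r. i \<noteq> j \<longrightarrow> A i \<times> A j \<subseteq> E)"
    proof (rule find)
      show "l \<le> card (X j)" if "j < r" for j
      proof (cases "j = i")
        case True
        then show ?thesis using W_ge[OF i] a_ge z_le' M0 R by (simp add: X_def l_def)
      next
        case False
        have "card (W j) \<le> card ((W j - nbrs E u) \<union> (W j - nbrs E v) \<union> (W j \<inter> nbrs E u \<inter> nbrs E v))"
          using finW[OF that] by (intro card_mono) auto
        also have "\<dots> \<le> card (W j - nbrs E u) + card (W j - nbrs E v) + card (W j \<inter> nbrs E u \<inter> nbrs E v)"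
          by (meson add_mono card_Un_le le_trans order_refl)
        finally have "real (card (W j)) \<le> real (card (W j - nbrs E u)) + card (W j - nbrs E v)
            + card (W j \<inter> nbrs E u \<inter> nbrs E v)" by (simp flip: of_nat_add)
        moreover have "card (W j - nbrs E u) \<le> z + l" "card (W j - nbrs E v) \<le> z + l"
          using miss_p[of j u] miss_p[of j v] that False u v eq by (auto simp: i_def)
        ultimately have "a - z \<le> (z + l) + (z + l) + card (W j \<inter> nbrs E u \<inter> nbrs E v)"
          using W_ge[OF that] by linarith
        moreover have "0 \<le> l" using M0 R by (simp add: l_def)
        ultimately show ?thesis using a_ge z_le' False by (simp add: X_def)
      qed
    qed (auto simp: X_def)
    then obtain A where "\<forall>i<r. A i \<subseteq> X i \<and> card (A i) = s"
      "\<forall>i<r. \<forall>j<r. i \<noteq> j \<longrightarrow> A i \<times> A j \<subseteq> E"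
      by (elim exE conjE)
    then have A: "\<And>i. i < r \<Longrightarrow> A i \<subseteq> X i \<and> card (A i) = s"
      "\<And>i j. i < r \<Longrightarrow> j < r \<Longrightarrow> i \<noteq> j \<Longrightarrow> A i \<times> A j \<subseteq> E"
      by simp_all
    have finA: "finite (A j)" if "j < r" for j
      using A(1)[OF that] assms by (intro card_ge_0_finite) simp
    define P where "P j = (if j = i then insert u (insert v (A i)) else A j)" for j
    have "contains_plus E r s"
    proof (rule contains_plusI[of r P s i u v])
      show "finite (P j) \<and> s \<le> card (P j)" if "j < r" for j
      proof -
        have "card (A j) \<le> card (P j)" using finA[OF i] finA[OF that]
          by (intro card_mono) (auto simp: P_def)
        then show ?thesis using A(1)[OF that] finA[OF that] finA[OF i] by (auto simp: P_def)
      qed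
      have *: "A j \<subseteq> nbrs E u \<inter> nbrs E v" if "j < r" "j \<noteq> i" for j
        using A(1)[OF that(1)] that by (auto simp: X_def)
      show "P j \<times> P k \<subseteq> E" if "j < r" "k < r" "j \<noteq> k" for j k
        using A(2)[OF that] *[of j] *[of k] that by (auto simp: P_def mem_nbrs symE subset_iff)
    qed (use assms i uv in \<open>auto simp: P_def\<close>)
    then show False using free by simp
  qed
  then show ?thesis using p by (intro exI[of _ p]) auto
qed

text \<open>The size hypothesis covers both stages: parts of size \<open>64 * r\<^sup>2 * s\<close>
  are sought in \<open>V\<close>, then parts of size \<open>s\<close> in subsets of clusters with at
  least \<open>card V / (8 * r)\<close> vertices, whence the factor
  \<open>8 * r * 4 * r\<close>.\<close>

lemma multipartite_if_plus_free:
  fixes V :: "'a set" and r s :: nat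
  assumes "r \<ge> 2" "s \<ge> 2" "finite V"
    and deg: "\<And>v. v \<in> V \<Longrightarrow> real (card (V - nbrs E v)) \<le> (1 / r + 1 / (80 * real r ^ 3)) * card V"
    and big: "32 * r\<^sup>2 * 4 ^ (r * (64 * r\<^sup>2 * s) * (2 * r) ^ (r - 1)) \<le> card V"
    and free: "\<not> contains_plus E r s"
  shows "\<exists>p. \<forall>v\<in>V. p v < r \<and> (\<forall>u\<in>V. (u, v) \<in> E \<longrightarrow> p u \<noteq> p v)"
proof -
  let ?N = "r * (64 * r\<^sup>2 * s) * (2 * r) ^ (r - 1)"
  have "4 * r * 4 ^ ?N \<le> 32 * r\<^sup>2 * 4 ^ ?N"
    using assms by (intro mult_right_mono) (auto simp: power2_eq_square)
  then have big1: "4 * r * 4 ^ ?N \<le> card V" using big by linarith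
  have "s \<le> 64 * r\<^sup>2 * s" using assms by simp
  then have "r * s * (2 * r) ^ (r - 1) \<le> ?N"
    by (intro mult_right_mono mult_left_mono) auto
  then have "32 * r\<^sup>2 * 4 ^ (r * s * (2 * r) ^ (r - 1)) \<le> 32 * r\<^sup>2 * 4 ^ ?N"
    by (intro mult_left_mono power_increasing) auto
  then have big2: "32 * r\<^sup>2 * 4 ^ (r * s * (2 * r) ^ (r - 1)) \<le> card V" using big by linarith
  obtain W where W: "\<forall>i<r. W i \<subseteq> V \<and> (\<forall>u\<in>W i. \<forall>w\<in>W i. (u, w) \<notin> E)"
    "\<forall>i<r. \<forall>j<r. i \<noteq> j \<longrightarrow> W i \<inter> W j = {}"
    "real (card (V - (\<Union>i<r. W i))) \<le> (1 / 20 + 1 / 16) / real r ^ 2 * card V"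
    using ex_independent_clusters[OF assms(1-4) big1 free] by blast
  show ?thesis
    by (rule multipartite_of_clusters[OF assms(1-4) big2 free _ _ _ W(3)]) (use W in auto)
qed

end

section \<open>The largest eigenvalue\<close>

text \<open>The entry at \<open>u\<close> of the adjacency matrix of \<open>E\<close> on
  \<open>V\<close> applied to \<open>x\<close>; \<open>adj_form\<close> is the associated bilinear
  form. Vectors are functions on the vertex type, so passing to an induced subgraph changes only
  \<open>V\<close>.\<close>

definition adj_sum :: "'a set \<Rightarrow> ('a \<times> 'a) set \<Rightarrow> ('a \<Rightarrow> real) \<Rightarrow> 'a \<Rightarrow> real" where
  "adj_sum V E x u = (\<Sum>v\<in>V. if (u, v) \<in> E then x v else 0)"

definition adj_form :: "'a set \<Rightarrow> ('a \<times> 'a) set \<Rightarrow> ('a \<Rightarrow> real) \<Rightarrow> ('a \<Rightarrow> real) \<Rightarrow> real" where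
  "adj_form V E x y = (\<Sum>u\<in>V. x u * adj_sum V E y u)"

lemma adj_sum_linear:
  "adj_sum V E (\<lambda>v. x v + t * y v) u = adj_sum V E x u + t * adj_sum V E y u"
  unfolding adj_sum_def sum_distrib_left sum.distrib[symmetric]
  by (rule sum.cong) auto

lemma adj_form_sym:
  assumes "\<And>u v. (u, v) \<in> E \<Longrightarrow> (v, u) \<in> E"
  shows "adj_form V E x y = adj_form V E y x"
proof -
  have "adj_form V E x y = (\<Sum>u\<in>V. \<Sum>v\<in>V. if (u, v) \<in> E then x u * y v else 0)"
    unfolding adj_form_def adj_sum_def by (simp add: sum_distrib_left if_distrib cong: if_cong)
  also have "\<dots> = (\<Sum>v\<in>V. \<Sum>u\<in>V. if (u, v) \<in> E then x u * y v else 0)" by (rule sum.swap)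
  also have "\<dots> = (\<Sum>v\<in>V. \<Sum>u\<in>V. if (v, u) \<in> E then y v * x u else 0)"
    using assms by (intro sum.cong refl) (metis mult.commute)
  also have "\<dots> = adj_form V E y x"
    unfolding adj_form_def adj_sum_def by (simp add: sum_distrib_left if_distrib cong: if_cong)
  finally show ?thesis .
qed

lemma adj_form_add:
  assumes "\<And>u v. (u, v) \<in> E \<Longrightarrow> (v, u) \<in> E"
  shows "adj_form V E (\<lambda>v. x v + t * y v) (\<lambda>v. x v + t * y v) =
    adj_form V E x x + 2 * t * adj_form V E y x + t\<^sup>2 * adj_form V E y y"
proof -
  have "adj_form V E (\<lambda>v. x v + t * y v) (\<lambda>v. x v + t * y v) =
    adj_form V E x x + t * adj_form V E x y + t * adj_form V E y x + t\<^sup>2 * adj_form V E y y"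
    unfolding adj_form_def adj_sum_linear sum_distrib_left sum.distrib[symmetric]
    by (rule sum.cong) (auto simp: algebra_simps power2_eq_square)
  then show ?thesis using adj_form_sym[OF assms, of V x y] by simp
qed

lemma adj_form_scale:
  assumes "\<And>v. v \<in> V \<Longrightarrow> y v = c * x v"
  shows "adj_form V E y y = c\<^sup>2 * adj_form V E x x"
proof -
  have "adj_sum V E y u = c * adj_sum V E x u" for u
    unfolding adj_sum_def sum_distrib_left using assms by (intro sum.cong) auto
  then show ?thesis unfolding adj_form_def sum_distrib_left using assms
    by (intro sum.cong) (auto simp: power2_eq_square algebra_simps)
qed

text \<open>The matrix entries are nonnegative. This is what makes a nonnegative Rayleigh maximizer
  available.\<close>

lemma adj_form_abs_ge: "adj_form V E x x \<le> adj_form V E (\<lambda>v. \<bar>x v\<bar>) (\<lambda>v. \<bar>x v\<bar>)"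
proof -
  have "x u * (if (u, v) \<in> E then x v else 0) \<le> \<bar>x u\<bar> * (if (u, v) \<in> E then \<bar>x v\<bar> else 0)" for u v
    using abs_ge_self[of "x u * x v"] by (auto simp: abs_mult)
  then show ?thesis
    unfolding adj_form_def adj_sum_def sum_distrib_left by (intro sum_mono)
qed

text \<open>In the product topology the unit sphere is compact once the coordinates in
  \<open>V\<close> are confined to \<open>[-1, 1]\<close> and all others are fixed at 0. The form is
  continuous and attains its maximum there; homogeneity extends the bound to every
  \<open>y\<close>.\<close>

lemma ex_rayleigh_maximizer:
  fixes V :: "'a set"
  assumes "finite V" "V \<noteq> {}"
  shows "\<exists>x. (\<Sum>v\<in>V. (x v)\<^sup>2) = 1 \<and> (\<forall>y. adj_form V E y y \<le> adj_form V E x x * (\<Sum>v\<in>V. (y v)\<^sup>2))"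
proof -
  define K :: "('a \<Rightarrow> real) set" where "K = PiE UNIV (\<lambda>v. if v \<in> V then {-1..1} else {0})"
  define S where "S = K \<inter> {x. (\<Sum>v\<in>V. (x v)\<^sup>2) = 1}"
  have "compactin (product_topology (\<lambda>i. euclidean) UNIV) K"
    unfolding K_def by (subst compactin_PiE) auto
  then have "compact K" by (simp add: euclidean_product_topology)
  moreover have "closed {x :: 'a \<Rightarrow> real. (\<Sum>v\<in>V. (x v)\<^sup>2) = 1}"
    by (intro closed_Collect_eq continuous_intros continuous_on_product_coordinates)
  ultimately have "compact S" unfolding S_def by (rule compact_Int_closed)
  moreover have "S \<noteq> {}"
  proof -
    obtain v0 where v0: "v0 \<in> V" using assms by auto
    have "(\<lambda>v. if v = v0 then 1 else 0) \<in> S"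
      using v0 \<open>finite V\<close> by (auto simp: S_def K_def if_distrib[of "\<lambda>a. a ^ 2"] cong: if_cong)
    then show ?thesis by auto
  qed
  moreover have "continuous_on S (\<lambda>x. adj_form V E x x)"
  proof -
    have "continuous_on UNIV (\<lambda>x :: 'a \<Rightarrow> real. if P then x v else 0)" for P v
      by (cases P) (simp_all add: continuous_on_product_coordinates)
    then have "continuous_on UNIV (\<lambda>x. adj_form V E x x)"
      unfolding adj_form_def adj_sum_def
      by (intro continuous_on_sum continuous_on_mult continuous_on_product_coordinates)
    then show ?thesis by (rule continuous_on_subset) simp
  qed
  ultimately have "\<exists>x\<in>S. \<forall>y\<in>S. adj_form V E y y \<le> adj_form V E x x"
    by (rule continuous_attains_sup)
  then obtain x where x: "x \<in> S" "\<And>y. y \<in> S \<Longrightarrow> adj_form V E y y \<le> adj_form V E x x"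
    by blast
  have "adj_form V E y y \<le> adj_form V E x x * (\<Sum>v\<in>V. (y v)\<^sup>2)" for y
  proof -
    define N where "N = (\<Sum>v\<in>V. (y v)\<^sup>2)"
    have "N \<ge> 0" unfolding N_def by (intro sum_nonneg) auto
    show ?thesis
    proof (cases "N = 0")
      case True
      then have "\<And>v. v \<in> V \<Longrightarrow> y v = 0 * y v"
        using \<open>finite V\<close> by (simp add: N_def sum_nonneg_eq_0_iff)
      then have "adj_form V E y y = 0\<^sup>2 * adj_form V E y y" by (rule adj_form_scale)
      then show ?thesis using True by (simp add: N_def)
    next
      case False
      then have N: "N > 0" using \<open>N \<ge> 0\<close> by simp
      define z where "z v = (if v \<in> V then y v / sqrt N else 0)" for v
      have sq: "(\<Sum>v\<in>V. (z v)\<^sup>2) = 1"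
        using N by (simp add: z_def power_divide flip: sum_divide_distrib N_def)
      moreover have "z \<in> K"
      proof -
        have "\<bar>z v\<bar> \<le> 1" if "v \<in> V" for v
        proof -
          have "(z v)\<^sup>2 \<le> (\<Sum>v\<in>V. (z v)\<^sup>2)" using that \<open>finite V\<close> by (intro member_le_sum) auto
          then show ?thesis using sq abs_le_square_iff[of "z v" 1] by simp
        qed
        then have "z v \<in> (if v \<in> V then {-1..1} else {0})" for v
          by (cases "v \<in> V") (simp add: abs_le_iff minus_le_iff, simp add: z_def)
        then show ?thesis by (simp add: K_def PiE_UNIV_domain Pi_def)
      qed
      ultimately have "adj_form V E z z \<le> adj_form V E x x" by (intro x) (simp add: S_def)
      moreover have "adj_form V E z z = (1 / sqrt N)\<^sup>2 * adj_form V E y y"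
        by (rule adj_form_scale) (simp add: z_def)
      ultimately show ?thesis using N by (simp add: power_divide field_simps flip: N_def)
    qed
  qed
  then show ?thesis using x(1) by (intro exI[of _ x]) (auto simp: S_def)
qed

text \<open>For small positive \<open>t\<close> a positive linear term would dominate the quadratic
  one.\<close>

lemma linear_le_quadratic_imp_nonpos:
  fixes b c :: real
  assumes "\<And>t. 2 * t * b \<le> t\<^sup>2 * c"
  shows "b \<le> 0"
proof (rule ccontr)
  assume "\<not> b \<le> 0"
  then have b: "b > 0" by simp
  \<comment> \<open>The added 1 keeps the denominator positive when \<open>c = 0\<close>;
    \<open>t * (\<bar>c\<bar> + 1) = b\<close> then clashes with
    \<open>2 * b \<le> t * c\<close>.\<close>
  define t where "t = b / (\<bar>c\<bar> + 1)"
  have t: "t > 0" using b by (simp add: t_def)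
  have "t * (2 * b) \<le> t * (t * c)" using assms[of t] by (simp add: power2_eq_square algebra_simps)
  then have "2 * b \<le> t * c" using t by simp
  also have "\<dots> \<le> t * (\<bar>c\<bar> + 1)" using t by (intro mult_left_mono) auto
  also have "\<dots> = b" by (simp add: t_def)
  finally show False using b by simp
qed

text \<open>Taking absolute values of a Rayleigh maximizer keeps its norm and does not lower the
  form, so a nonnegative maximizer exists; being critical, it is an eigenvector.\<close>

lemma ex_perron_vector:
  fixes V :: "'a set"
  assumes "finite V" "V \<noteq> {}" and sym: "\<And>u v. (u, v) \<in> E \<Longrightarrow> (v, u) \<in> E"
  shows "\<exists>\<mu> x. (\<forall>v. 0 \<le> x v) \<and> (\<Sum>v\<in>V. (x v)\<^sup>2) = 1 \<and> (\<forall>u\<in>V. adj_sum V E x u = \<mu> * x u) \<and>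
    (\<forall>y. adj_form V E y y \<le> \<mu> * (\<Sum>v\<in>V. (y v)\<^sup>2))"
proof -
  obtain x0 where x0: "(\<Sum>v\<in>V. (x0 v)\<^sup>2) = 1"
    "\<And>y. adj_form V E y y \<le> adj_form V E x0 x0 * (\<Sum>v\<in>V. (y v)\<^sup>2)"
    using ex_rayleigh_maximizer[OF assms(1,2)] by blast
  define x where "x v = \<bar>x0 v\<bar>" for v
  define m where "m = adj_form V E x0 x0"
  have norm: "(\<Sum>v\<in>V. (x v)\<^sup>2) = 1" using x0 by (simp add: x_def)
  have max: "adj_form V E y y \<le> m * (\<Sum>v\<in>V. (y v)\<^sup>2)" for y using x0 by (simp add: m_def)
  have m: "m \<le> adj_form V E x x" unfolding m_def x_def by (rule adj_form_abs_ge)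
  \<comment> \<open>Perturbing the maximizer in the direction of its own residual shows that the residual vanishes.\<close>
  define h where "h v = adj_sum V E x v - m * x v" for v
  have "(\<Sum>v\<in>V. (h v)\<^sup>2) \<le> 0"
  proof (rule linear_le_quadratic_imp_nonpos)
    fix t :: real
    have "adj_form V E x x + 2 * t * adj_form V E h x + t\<^sup>2 * adj_form V E h h
      \<le> m * (\<Sum>v\<in>V. (x v + t * h v)\<^sup>2)"
      using max[of "\<lambda>v. x v + t * h v"] adj_form_add[OF sym, of V x t h] by simp
    also have "(\<Sum>v\<in>V. (x v + t * h v)\<^sup>2) =
        (\<Sum>v\<in>V. (x v)\<^sup>2) + 2 * t * (\<Sum>v\<in>V. h v * x v) + t\<^sup>2 * (\<Sum>v\<in>V. (h v)\<^sup>2)"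
      unfolding sum_distrib_left sum.distrib[symmetric]
      by (rule sum.cong) (auto simp: algebra_simps power2_eq_square)
    finally have "2 * t * (adj_form V E h x - m * (\<Sum>v\<in>V. h v * x v))
      \<le> t\<^sup>2 * (m * (\<Sum>v\<in>V. (h v)\<^sup>2) - adj_form V E h h)"
      using m norm by (simp add: algebra_simps)
    moreover have "adj_form V E h x - m * (\<Sum>v\<in>V. h v * x v) = (\<Sum>v\<in>V. (h v)\<^sup>2)"
      unfolding adj_form_def sum_distrib_left sum_subtractf[symmetric]
      by (rule sum.cong) (auto simp: h_def algebra_simps power2_eq_square)
    ultimately show "2 * t * (\<Sum>v\<in>V. (h v)\<^sup>2) \<le> t\<^sup>2 * (m * (\<Sum>v\<in>V. (h v)\<^sup>2) - adj_form V E h h)"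
      by simp
  qed
  moreover have "(\<Sum>v\<in>V. (h v)\<^sup>2) \<ge> 0" by (intro sum_nonneg) auto
  ultimately have "\<forall>v\<in>V. h v = 0" using \<open>finite V\<close> by (simp add: sum_nonneg_eq_0_iff)
  then show ?thesis using norm max by (intro exI[of _ m] exI[of _ x]) (auto simp: h_def x_def)
qed

text \<open>
  Only the arcs of \<open>E\<close> inside \<open>V\<close> matter, so \<open>top_eigenvalue E W\<close> for \<open>W \<subseteq> V\<close> is the largest
  eigenvalue of the induced subgraph.
\<close>

abbreviation top_eigenvalue :: "('a \<times> 'a) set \<Rightarrow> 'a set \<Rightarrow> real" where
  "top_eigenvalue E V \<equiv> largest_eigenvalue \<lparr>pverts = V, parcs = E\<rparr>"

text \<open>The Rayleigh maximum is attained at an eigenvector, and every eigenvalue is the Rayleigh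
  quotient of its eigenvector, so the maximum of the spectrum is the Rayleigh maximum. All later
  eigenvalue estimates rest on these two conclusions.\<close>

lemma top_eigenvalue:
  fixes V :: "'a set"
  assumes "finite V" "V \<noteq> {}" and sym: "\<And>u v. (u, v) \<in> E \<Longrightarrow> (v, u) \<in> E"
  shows ex_top_eigenvector: "\<exists>x. (\<forall>v. 0 \<le> x v) \<and> (\<Sum>v\<in>V. (x v)\<^sup>2) = 1 \<and>
      (\<forall>u\<in>V. adj_sum V E x u = top_eigenvalue E V * x u)"
    and rayleigh_le: "adj_form V E y y \<le> top_eigenvalue E V * (\<Sum>v\<in>V. (y v)\<^sup>2)"
proof -
  let ?G = "\<lparr>pverts = V, parcs = E\<rparr>"
  obtain m x where x: "\<And>v. 0 \<le> x v" "(\<Sum>v\<in>V. (x v)\<^sup>2) = 1" "\<And>u. u \<in> V \<Longrightarrow> adj_sum V E x u = m * x u"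
    and max: "\<And>y. adj_form V E y y \<le> m * (\<Sum>v\<in>V. (y v)\<^sup>2)"
    using ex_perron_vector[OF assms] by blast
  have vs: "distinct (vertex_list ?G)" "set (vertex_list ?G) = pverts ?G"
    using vertex_list[of ?G] \<open>finite V\<close> by auto
  have ev: "eigenvalue (adjacency_matrix ?G) k \<longleftrightarrow>
      (\<exists>f. (\<exists>v\<in>V. f v \<noteq> 0) \<and> (\<forall>u\<in>V. adj_sum V E f u = k * f u))" for k
    unfolding adjacency_matrix_def adj_sum_def using eigenvalue_adjacency_matrix_on[OF vs] by simp
  have "top_eigenvalue E V = m"
    unfolding largest_eigenvalue_def
  proof (rule Max_eqI)
    have "adjacency_matrix ?G \<in> carrier_mat (length (vertex_list ?G)) (length (vertex_list ?G))"
      by (simp add: adjacency_matrix_def adjacency_matrix_on_def)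
    then show "finite (spectrum (adjacency_matrix ?G))" by (rule card_finite_spectrum)
    have "\<exists>v\<in>V. x v \<noteq> 0"
    proof (rule ccontr)
      assume "\<not> ?thesis"
      then have "(\<Sum>v\<in>V. (x v)\<^sup>2) = 0" by (intro sum.neutral) auto
      then show False using x(2) by simp
    qed
    then show "m \<in> spectrum (adjacency_matrix ?G)"
      unfolding spectrum_def using ev x(3) by blast
    show "k \<le> m" if "k \<in> spectrum (adjacency_matrix ?G)" for k
    proof -
      have "eigenvalue (adjacency_matrix ?G) k" using that by (simp add: spectrum_def)
      then obtain f where f: "\<exists>v\<in>V. f v \<noteq> 0" "\<And>u. u \<in> V \<Longrightarrow> adj_sum V E f u = k * f u"
        using ev[of k] by blast
      have "k * (\<Sum>v\<in>V. (f v)\<^sup>2) = adj_form V E f f"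
        unfolding adj_form_def sum_distrib_left using f(2)
        by (intro sum.cong) (auto simp: power2_eq_square)
      also have "\<dots> \<le> m * (\<Sum>v\<in>V. (f v)\<^sup>2)" by (rule max)
      finally show ?thesis
        using f(1) \<open>finite V\<close> sum_pos2[of V _ "\<lambda>v. (f v)\<^sup>2"] by (auto simp: mult_le_cancel_right)
    qed
  qed
  then show "\<exists>x. (\<forall>v. 0 \<le> x v) \<and> (\<Sum>v\<in>V. (x v)\<^sup>2) = 1 \<and>
      (\<forall>u\<in>V. adj_sum V E x u = top_eigenvalue E V * x u)"
    and "adj_form V E y y \<le> top_eigenvalue E V * (\<Sum>v\<in>V. (y v)\<^sup>2)"
    using x max by auto
qed

text \<open>The Collatz-Wielandt lower bound: weighting the inequality at each vertex by
  \<open>y v\<close> bounds the Rayleigh quotient of \<open>y\<close> from below.\<close>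

lemma top_eigenvalue_geI:
  fixes V :: "'a set"
  assumes V: "finite V" "V \<noteq> {}" and sym: "\<And>u v. (u, v) \<in> E \<Longrightarrow> (v, u) \<in> E"
    and y: "\<And>v. v \<in> V \<Longrightarrow> 0 < y v" "\<And>v. v \<in> V \<Longrightarrow> k * y v \<le> adj_sum V E y v"
  shows "k \<le> top_eigenvalue E V"
proof -
  have "k * (\<Sum>v\<in>V. (y v)\<^sup>2) \<le> adj_form V E y y"
    unfolding adj_form_def sum_distrib_left
  proof (rule sum_mono)
    fix v assume v: "v \<in> V"
    have "y v * (k * y v) \<le> y v * adj_sum V E y v"
      using y[OF v] by (intro mult_left_mono) auto
    then show "k * (y v)\<^sup>2 \<le> y v * adj_sum V E y v" by (simp add: power2_eq_square algebra_simps)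
  qed
  also have "\<dots> \<le> top_eigenvalue E V * (\<Sum>v\<in>V. (y v)\<^sup>2)" by (rule rayleigh_le[OF V sym])
  finally show ?thesis
    using V y(1) sum_pos[of V "\<lambda>v. (y v)\<^sup>2"] by (force simp: mult_le_cancel_right)
qed

lemma adj_sum_nonneg: "(\<And>v. v \<in> V \<Longrightarrow> 0 \<le> x v) \<Longrightarrow> 0 \<le> adj_sum V E x u"
  unfolding adj_sum_def by (intro sum_nonneg) auto

lemma top_eigenvalue_nonneg:
  assumes "finite V" "V \<noteq> {}" "\<And>u v. (u, v) \<in> E \<Longrightarrow> (v, u) \<in> E"
  shows "0 \<le> top_eigenvalue E V"
  by (rule top_eigenvalue_geI[where y = "\<lambda>_. 1"]) (use assms adj_sum_nonneg[of V "\<lambda>_. 1"] in auto)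

text \<open>Summing the eigenvector equation over all vertices compares both sides with the positive
  total weight \<open>S\<close>.\<close>

lemma top_eigenvalue_le_card:
  assumes "finite V" "V \<noteq> {}" and sym: "\<And>u v. (u, v) \<in> E \<Longrightarrow> (v, u) \<in> E"
  shows "top_eigenvalue E V \<le> card V"
proof -
  obtain x where x: "\<And>v. 0 \<le> x v" "(\<Sum>v\<in>V. (x v)\<^sup>2) = 1"
    "\<And>u. u \<in> V \<Longrightarrow> adj_sum V E x u = top_eigenvalue E V * x u"
    using ex_top_eigenvector[OF assms] by blast
  define S where "S = (\<Sum>v\<in>V. x v)"
  have "top_eigenvalue E V * S = (\<Sum>u\<in>V. adj_sum V E x u)"
    using x(3) by (simp add: S_def sum_distrib_left)
  also have "\<dots> \<le> (\<Sum>u\<in>V. S)"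
    unfolding S_def adj_sum_def using x(1) by (intro sum_mono) auto
  also have "\<dots> = card V * S" by simp
  finally have le: "top_eigenvalue E V * S \<le> card V * S" .
  have "S \<noteq> 0"
  proof
    assume "S = 0"
    then have "\<forall>v\<in>V. x v = 0" using x(1) \<open>finite V\<close> by (simp add: S_def sum_nonneg_eq_0_iff)
    then show False using x(2) by simp
  qed
  moreover have "S \<ge> 0" unfolding S_def using x(1) by (intro sum_nonneg) auto
  ultimately show ?thesis using le by simp
qed

section \<open>Turan graphs and multipartite graphs\<close>

lemma top_eigenvalue_graph: "top_eigenvalue (parcs G) (pverts G) = largest_eigenvalue G"
  by (cases G) simp

text \<open>The function \<open>k / (m + k)\<close> is concave in \<open>k\<close>, so its chord
  through \<open>q\<close> and \<open>q + 1\<close> lies above it outside the open interval between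
  them, which contains no integer. The last factor is the slope of the chord.\<close>

lemma chord_bound:
  fixes m :: real and k q :: nat
  assumes "m > 0"
  shows "real k / (m + k) \<le> real q / (m + q) + (real k - q) * (m / ((m + q) * (m + q + 1)))"
proof -
  have "(real k - q) * (real q + 1 - k) \<le> 0"
  proof (cases "k \<le> q")
    case True
    then show ?thesis by (intro mult_nonpos_nonneg) auto
  next
    case False
    then show ?thesis by (intro mult_nonneg_nonpos) auto
  qed
  then have le: "m * ((real k - q) * (real q + 1 - k)) / ((m + k) * (m + q) * (m + q + 1)) \<le> 0"
    using assms by (simp add: divide_le_0_iff mult_le_0_iff)
  have p: "m + k \<noteq> 0" "m + q \<noteq> 0" "m + q + 1 \<noteq> 0" using assms by linarith+
  have "real k / (m + k) - real q / (m + q) - (real k - q) * (m / ((m + q) * (m + q + 1))) =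
    m * ((real k - q) * (real q + 1 - k)) / ((m + k) * (m + q) * (m + q + 1))"
    using p by (simp add: divide_simps) (simp add: algebra_simps)
  then show ?thesis using le by linarith
qed

text \<open>By concavity the tangent at \<open>a\<close> lies above the graph of
  \<open>k / (m + k)\<close>.\<close>

lemma tangent_bound:
  fixes m k a :: real
  assumes "m > 0" "k \<ge> 0" "a \<ge> 0"
  shows "k / (m + k) \<le> a / (m + a) + (k - a) * (m / (m + a)\<^sup>2)"
proof -
  have le: "0 \<le> m * (k - a)\<^sup>2 / ((m + k) * (m + a)\<^sup>2)" using assms by simp
  have p: "m + k \<noteq> 0" "m + a \<noteq> 0" using assms by linarith+
  have "a / (m + a) + (k - a) * (m / (m + a)\<^sup>2) - k / (m + k) = m * (k - a)\<^sup>2 / ((m + k) * (m + a)\<^sup>2)"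
    using p by (simp add: divide_simps) (simp add: algebra_simps power2_eq_square)
  then show ?thesis using le by linarith
qed

section \<open>The largest eigenvalue of the Turan graph\<close>

definition turan_part :: "nat \<Rightarrow> nat \<Rightarrow> nat \<Rightarrow> nat" where
  "turan_part r n i = n div r + (if i < n mod r then 1 else 0)"

lemma sum_turan_part_affine:
  fixes a b :: real and r n :: nat
  assumes "r > 0"
  shows "(\<Sum>i<r. if i < n mod r then a else b) = r * b + (n mod r) * (a - b)"
proof -
  have "{..<r} \<inter> {i. i < n mod r} = {..<n mod r}"
    using mod_less_divisor[OF assms, of n] by auto
  moreover have "{..<r} \<inter> - {i. i < n mod r} = {n mod r..<r}" by auto
  moreover have "n mod r \<le> r" using mod_less_divisor[OF assms, of n] by simp
  ultimately show ?thesis by (simp add: sum.If_cases of_nat_diff algebra_simps)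
qed

lemma pverts_turan_graph: "pverts (turan_graph r n) = (SIGMA i:{..<r}. {..<turan_part r n i})"
  by (auto simp: turan_graph_def pverts_complete_multipartite turan_part_def)

lemma adj_sum_turan_graph:
  fixes g :: "nat \<Rightarrow> real"
  assumes "u \<in> pverts (turan_graph r n)"
  shows "adj_sum (pverts (turan_graph r n)) (parcs (turan_graph r n)) (\<lambda>v. g (fst v)) u =
    (\<Sum>i<r. turan_part r n i * g i) - turan_part r n (fst u) * g (fst u)"
proof -
  let ?V = "pverts (turan_graph r n)"
  have u: "fst u < r" using assms by (auto simp: pverts_turan_graph)
  have "adj_sum ?V (parcs (turan_graph r n)) (\<lambda>v. g (fst v)) u =
      (\<Sum>v\<in>?V. if fst v \<noteq> fst u then g (fst v) else 0)"
    unfolding adj_sum_def using assms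
    by (intro sum.cong refl) (auto simp: turan_graph_def parcs_complete_multipartite)
  also have "\<dots> = (\<Sum>i<r. \<Sum>j<turan_part r n i. if i \<noteq> fst u then g i else 0)"
    unfolding pverts_turan_graph by (subst sum.Sigma) (auto intro!: sum.cong)
  also have "\<dots> = (\<Sum>i<r. turan_part r n i * g i - (if i = fst u then turan_part r n i * g i else 0))"
    by (intro sum.cong refl) auto
  also have "\<dots> = (\<Sum>i<r. turan_part r n i * g i) - turan_part r n (fst u) * g (fst u)"
    using u by (simp add: sum_subtractf)
  finally show ?thesis .
qed

lemma turan_graph_basics:
  assumes "r > 0" "n > 0"
  shows "finite (pverts (turan_graph r n))" "pverts (turan_graph r n) \<noteq> {}"
    "(u, v) \<in> parcs (turan_graph r n) \<Longrightarrow> (v, u) \<in> parcs (turan_graph r n)"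
proof -
  show "finite (pverts (turan_graph r n))" by (simp add: pverts_turan_graph)
  show "pverts (turan_graph r n) \<noteq> {}"
    using card_turan_graph[OF assms(1), of n] assms(2) by (metis card.empty less_numeral_extra(3))
  show "(u, v) \<in> parcs (turan_graph r n) \<Longrightarrow> (v, u) \<in> parcs (turan_graph r n)"
    by (auto simp: turan_graph_def parcs_complete_multipartite)
qed

text \<open>The all-ones vector has the average degree as its Rayleigh quotient. Rounding of the
  part sizes raises the sum of their squares above \<open>n^2 / r\<close> by at most
  \<open>r\<close>, which costs \<open>r / n\<close>.\<close>

lemma largest_eigenvalue_turan_graph_ge:
  assumes "r > 0" "n > 0"
  shows "(1 - 1 / r) * n - r / n \<le> largest_eigenvalue (turan_graph r n)"
proof -
  let ?V = "pverts (turan_graph r n)" and ?E = "parcs (turan_graph r n)"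
  define t where "t i = real (turan_part r n i)" for i
  define q where "q = real (n div r)"
  define p where "p = real (n mod r)"
  define R where "R = real r"
  have R: "R > 0" using assms by (simp add: R_def)
  have n: "real n = R * q + p"
    unfolding R_def q_def p_def by (metis mult_div_mod_eq of_nat_add of_nat_mult)
  have pR: "0 \<le> p" "p \<le> R" using mod_less_divisor[OF assms(1), of n] by (auto simp: p_def R_def)
  have sum_t: "(\<Sum>i<r. t i) = real n"
    using sum_turan_part_affine[OF assms(1), of n "q + 1" q] n
    by (simp add: t_def turan_part_def q_def p_def R_def if_distrib add.commute cong: if_cong)
  have sum_t2: "(\<Sum>i<r. t i * t i) = R * q\<^sup>2 + p * (2 * q + 1)"
    using sum_turan_part_affine[OF assms(1), of n "(q + 1)\<^sup>2" "q\<^sup>2"]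
    by (simp add: t_def turan_part_def q_def p_def R_def if_distrib power2_eq_square algebra_simps cong: if_cong)
  have "adj_form ?V ?E (\<lambda>_. 1) (\<lambda>_. 1) = (\<Sum>u\<in>?V. real n - t (fst u))"
    unfolding adj_form_def using adj_sum_turan_graph[of _ r n "\<lambda>_. 1"] sum_t
    by (intro sum.cong refl) (auto simp: t_def)
  also have "\<dots> = (\<Sum>i<r. \<Sum>j<turan_part r n i. real n - t i)"
    unfolding pverts_turan_graph by (subst sum.Sigma) (auto intro!: sum.cong)
  also have "\<dots> = (\<Sum>i<r. real n * t i - t i * t i)"
    by (intro sum.cong refl) (simp add: t_def algebra_simps)
  also have "\<dots> = real n * real n - (R * q\<^sup>2 + p * (2 * q + 1))"
    by (simp add: sum_subtractf sum_t sum_t2 flip: sum_distrib_left)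
  finally have "real n * real n - (R * q\<^sup>2 + p * (2 * q + 1)) \<le> largest_eigenvalue (turan_graph r n) * n"
    using rayleigh_le[OF turan_graph_basics[OF assms], of "\<lambda>_. 1"] card_turan_graph[OF assms(1), of n]
    by (simp add: top_eigenvalue_graph)
  moreover have "R * q\<^sup>2 + p * (2 * q + 1) \<le> real n * real n / R + R"
  proof -
    have "real n * real n / R = R * q\<^sup>2 + 2 * p * q + p\<^sup>2 / R"
      using R by (simp add: n field_simps power2_eq_square)
    moreover have "0 \<le> p\<^sup>2 / R" using R by simp
    moreover have "p * (2 * q + 1) = 2 * p * q + p" by (simp add: algebra_simps)
    ultimately show ?thesis using pR by linarith
  qed
  ultimately have "real n * real n - real n * real n / R - R \<le> largest_eigenvalue (turan_graph r n) * n"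
    by linarith
  then have "(real n * real n - real n * real n / R - R) / n \<le> largest_eigenvalue (turan_graph r n)"
    using assms by (simp add: divide_le_eq)
  moreover have "(real n * real n - real n * real n / R - R) / n = (1 - 1 / R) * n - R / n"
    using assms R by (simp add: field_simps)
  ultimately show ?thesis by (simp add: R_def)
qed

text \<open>
  For a complete multipartite graph equality holds, and this is the equation of its largest
  eigenvalue.
\<close>

lemma multipartite_eigenvalue_equation:
  fixes V :: "'a set" and p :: "'a \<Rightarrow> nat"
  assumes V: "finite V" "V \<noteq> {}" and sym: "\<And>u v. (u, v) \<in> E \<Longrightarrow> (v, u) \<in> E"
    and p: "\<And>v. v \<in> V \<Longrightarrow> p v < r" "\<And>u v. u \<in> V \<Longrightarrow> v \<in> V \<Longrightarrow> (u, v) \<in> E \<Longrightarrow> p u \<noteq> p v"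
    and pos: "top_eigenvalue E V > 0"
  shows "1 \<le> (\<Sum>i<r. real (card {v \<in> V. p v = i}) / (top_eigenvalue E V + card {v \<in> V. p v = i}))"
proof -
  define m where "m = top_eigenvalue E V"
  define C where "C i = {v \<in> V. p v = i}" for i
  obtain x where x: "\<And>v. 0 \<le> x v" "(\<Sum>v\<in>V. (x v)\<^sup>2) = 1"
    "\<And>u. u \<in> V \<Longrightarrow> adj_sum V E x u = m * x u"
    using ex_top_eigenvector[OF V sym] unfolding m_def by blast
  define S where "S = (\<Sum>v\<in>V. x v)"
  define s where "s i = (\<Sum>v\<in>C i. x v)" for i
  have S_eq: "S = (\<Sum>i<r. s i)"
    unfolding S_def s_def C_def using V p(1) by (intro sum.group[symmetric]) auto
  \<comment> \<open>A vertex receives no weight from its own class. Summing over the class and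
    solving for \<open>s i\<close> gives its share of the total weight; the shares add up to
    1.\<close>
  have "m * x u \<le> S - s i" if "u \<in> C i" for u i
  proof -
    have u: "u \<in> V" "p u = i" using that by (auto simp: C_def)
    have "m * x u = (\<Sum>v\<in>V. if (u, v) \<in> E then x v else 0)"
      using x(3)[OF u(1)] by (simp add: adj_sum_def)
    also have "\<dots> \<le> (\<Sum>v\<in>V. if v \<in> C i then 0 else x v)"
    proof (rule sum_mono)
      fix v assume "v \<in> V"
      then have "(u, v) \<in> E \<Longrightarrow> v \<notin> C i" using p(2)[OF u(1), of v] u by (auto simp: C_def)
      then show "(if (u, v) \<in> E then x v else 0) \<le> (if v \<in> C i then 0 else x v)"
        using x(1)[of v] by auto
    qed
    also have "\<dots> = (\<Sum>v\<in>V - C i. x v)"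
      using V by (simp add: sum.If_cases Diff_eq)
    also have "\<dots> = S - s i" unfolding S_def s_def
      using V by (intro sum_diff) (auto simp: C_def)
    finally show ?thesis .
  qed
  then have "(\<Sum>u\<in>C i. m * x u) \<le> card (C i) * (S - s i)" for i
    using sum_bounded_above[of "C i" "\<lambda>u. m * x u" "S - s i"] by auto
  then have "m * s i \<le> card (C i) * (S - s i)" for i by (simp add: s_def sum_distrib_left)
  then have s_le: "s i \<le> card (C i) / (m + card (C i)) * S" for i
    using pos by (simp add: m_def field_simps)
  have "S \<noteq> 0"
  proof
    assume "S = 0"
    then have "\<forall>v\<in>V. x v = 0" using x(1) V by (simp add: S_def sum_nonneg_eq_0_iff)
    then show False using x(2) by simp
  qed
  moreover have "S \<ge> 0" unfolding S_def using x(1) by (intro sum_nonneg) auto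
  ultimately have S: "S > 0" by simp
  have "1 * S \<le> (\<Sum>i<r. card (C i) / (m + card (C i))) * S"
    unfolding sum_distrib_right using S_eq sum_mono[OF s_le, of "\<lambda>i. i" "{..<r}"] by simp
  then show ?thesis using S by (simp add: m_def C_def)
qed

section \<open>Upper bounds for multipartite graphs\<close>

lemma sum_card_colour_classes:
  fixes V :: "'a set" and p :: "'a \<Rightarrow> nat"
  assumes "finite V" "\<And>v. v \<in> V \<Longrightarrow> p v < r"
  shows "(\<Sum>i<r. real (card {v \<in> V. p v = i})) = card V"
proof -
  have "(\<Sum>i<r. card {v \<in> V. p v = i}) = card V"
    using sum.group[of V "{..<r}" p "\<lambda>_. 1::nat"] assms by auto
  then show ?thesis by (metis of_nat_sum)
qed

text \<open>In the eigenvalue equation each class size is replaced through the tangent at the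
  average size \<open>a\<close>; the linear terms cancel in the sum and leave
  \<open>m + a \<le> card V\<close>.\<close>

lemma multipartite_top_eigenvalue_le:
  fixes V :: "'a set" and p :: "'a \<Rightarrow> nat"
  assumes "r > 0" and V: "finite V" "V \<noteq> {}" and sym: "\<And>u v. (u, v) \<in> E \<Longrightarrow> (v, u) \<in> E"
    and p: "\<And>v. v \<in> V \<Longrightarrow> p v < r" "\<And>u v. u \<in> V \<Longrightarrow> v \<in> V \<Longrightarrow> (u, v) \<in> E \<Longrightarrow> p u \<noteq> p v"
  shows "top_eigenvalue E V \<le> (1 - 1 / r) * card V"
proof (cases "top_eigenvalue E V > 0")
  case False
  have "0 \<le> (1 - 1 / real r) * card V" using \<open>r > 0\<close> by (intro mult_nonneg_nonneg) auto
  then show ?thesis using False by linarith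
next
  case True
  define m where "m = top_eigenvalue E V"
  define c where "c i = real (card {v \<in> V. p v = i})" for i
  define a where "a = card V / real r"
  have m: "m > 0" using True by (simp add: m_def)
  have "1 \<le> (\<Sum>i<r. c i / (m + c i))"
    using multipartite_eigenvalue_equation[OF V sym p True] by (simp add: m_def c_def)
  also have "\<dots> \<le> (\<Sum>i<r. a / (m + a) + (c i - a) * (m / (m + a)\<^sup>2))"
    using m by (intro sum_mono tangent_bound) (auto simp: a_def c_def)
  also have "\<dots> = r * (a / (m + a)) + (card V - r * a) * (m / (m + a)\<^sup>2)"
    using sum_card_colour_classes[OF V(1) p(1)]
    by (simp add: sum.distrib sum_subtractf c_def flip: sum_distrib_right sum_divide_distrib)
  also have "\<dots> = card V / (m + a)" using \<open>r > 0\<close> by (simp add: a_def)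
  finally have "1 \<le> card V / (m + a)" .
  moreover have "m + a > 0" using m by (simp add: a_def add_pos_nonneg)
  ultimately have "m + a \<le> card V" by simp
  then show ?thesis by (simp add: m_def a_def algebra_simps)
qed

text \<open>The chord at \<open>n div r\<close> is exact at both part sizes of the Turan graph and
  the class sizes have the same sum, so the inequality of the eigenvalue equation passes to the
  Turan part sizes. It then provides a test vector on the Turan graph.\<close>

lemma multipartite_top_eigenvalue_le_turan:
  fixes V :: "'a set" and p :: "'a \<Rightarrow> nat"
  assumes "r > 0" and V: "finite V" "V \<noteq> {}" and sym: "\<And>u v. (u, v) \<in> E \<Longrightarrow> (v, u) \<in> E"
    and p: "\<And>v. v \<in> V \<Longrightarrow> p v < r" "\<And>u v. u \<in> V \<Longrightarrow> v \<in> V \<Longrightarrow> (u, v) \<in> E \<Longrightarrow> p u \<noteq> p v"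
  shows "top_eigenvalue E V \<le> largest_eigenvalue (turan_graph r (card V))"
proof -
  define n where "n = card V"
  let ?V = "pverts (turan_graph r n)" and ?E = "parcs (turan_graph r n)"
  have n: "n > 0" using V by (simp add: n_def card_gt_0_iff)
  note T = turan_graph_basics[OF \<open>r > 0\<close> n]
  have "top_eigenvalue E V \<le> top_eigenvalue ?E ?V"
  proof (cases "top_eigenvalue E V > 0")
    case False
    then show ?thesis using top_eigenvalue_nonneg[OF T] by simp
  next
    case True
    define m where "m = top_eigenvalue E V"
    define c where "c i = real (card {v \<in> V. p v = i})" for i
    define t where "t i = real (turan_part r n i)" for i
    define q where "q = n div r"
    define d where "d = m / ((m + q) * (m + q + 1))"
    have m: "m > 0" using True by (simp add: m_def)
    have "1 \<le> (\<Sum>i<r. c i / (m + c i))"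
      using multipartite_eigenvalue_equation[OF V sym p True] by (simp add: m_def c_def)
    also have "\<dots> \<le> (\<Sum>i<r. real q / (m + q) + (c i - q) * d)"
      unfolding d_def c_def using m by (intro sum_mono chord_bound)
    also have "\<dots> = r * (real q / (m + q)) + (real n - r * q) * d"
      using sum_card_colour_classes[OF V(1) p(1)]
      by (simp add: sum.distrib sum_subtractf c_def n_def flip: sum_distrib_right sum_divide_distrib)
    also have "real n - r * q = n mod r"
      unfolding q_def by (metis add_diff_cancel_left' mult_div_mod_eq of_nat_add of_nat_mult)
    also have "d = real (q + 1) / (m + real (q + 1)) - real q / (m + q)"
    proof -
      have "m + q \<noteq> 0" "m + q + 1 \<noteq> 0" using m by linarith+
      then show ?thesis unfolding d_def by (simp add: divide_simps) (simp add: algebra_simps)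
    qed
    also have "r * (real q / (m + q)) + (n mod r) * (real (q + 1) / (m + real (q + 1)) - real q / (m + q)) =
        (\<Sum>i<r. if i < n mod r then real (q + 1) / (m + real (q + 1)) else real q / (m + q))"
      by (rule sum_turan_part_affine[OF \<open>r > 0\<close>, symmetric])
    also have "\<dots> = (\<Sum>i<r. t i / (m + t i))"
      by (intro sum.cong refl) (auto simp: t_def turan_part_def q_def add.commute)
    finally have one: "1 \<le> (\<Sum>i<r. t i / (m + t i))" .
    have "m \<le> top_eigenvalue ?E ?V"
    \<comment> \<open>An eigenvector of a complete multipartite graph for eigenvalue
      \<open>m\<close> has entries proportional to \<open>1 / (m + part size)\<close>; with the sum
      only known to be at least 1, this vector satisfies the eigenvector equation as an
      inequality.\<close>
    proof (rule top_eigenvalue_geI[OF T, where y = "\<lambda>v. 1 / (m + t (fst v))"])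
      fix v assume v: "v \<in> ?V"
      have mt: "m + t (fst v) > 0" using m by (simp add: t_def add_pos_nonneg)
      then show "0 < 1 / (m + t (fst v))" by simp
      have "adj_sum ?V ?E (\<lambda>v. 1 / (m + t (fst v))) v = (\<Sum>i<r. t i / (m + t i)) - t (fst v) / (m + t (fst v))"
        using adj_sum_turan_graph[OF v, of "\<lambda>i. 1 / (m + t i)"] by (simp add: t_def)
      moreover have "m * (1 / (m + t (fst v))) = 1 - t (fst v) / (m + t (fst v))"
        using mt by (simp add: field_simps)
      ultimately show "m * (1 / (m + t (fst v))) \<le> adj_sum ?V ?E (\<lambda>v. 1 / (m + t (fst v))) v"
        using one by simp
    qed
    then show ?thesis by (simp add: m_def)
  qed
  then show ?thesis by (simp add: n_def top_eigenvalue_graph)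
qed

section \<open>Passing to an induced subgraph of large minimum degree\<close>

text \<open>Removing the row and the column of \<open>w\<close> costs
  \<open>x w * adj_sum W E x w = m * (x w)\<^sup>2\<close> each; there is no diagonal entry to
  correct for.\<close>

lemma (in simple_edges) adj_form_delete:
  assumes "finite W" "w \<in> W" and ev: "\<And>u. u \<in> W \<Longrightarrow> adj_sum W E x u = m * x u"
    and norm: "(\<Sum>v\<in>W. (x v)\<^sup>2) = 1"
  shows "adj_form (W - {w}) E x x = m - 2 * m * (x w)\<^sup>2"
proof -
  have sum': "adj_sum (W - {w}) E x u = adj_sum W E x u - (if (u, w) \<in> E then x w else 0)" for u
    unfolding adj_sum_def using assms(1,2) by (simp add: sum_diff1)
  have "(\<Sum>u\<in>W - {w}. x u * (if (u, w) \<in> E then x w else 0)) = x w * adj_sum W E x w"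
  proof -
    have "(\<Sum>u\<in>W - {w}. x u * (if (u, w) \<in> E then x w else 0)) =
        (\<Sum>u\<in>W. x u * (if (u, w) \<in> E then x w else 0))"
      using assms(1,2) irreflE by (simp add: sum_diff1)
    also have "\<dots> = x w * adj_sum W E x w"
      unfolding adj_sum_def sum_distrib_left using symE by (intro sum.cong refl) auto
    finally show ?thesis .
  qed
  moreover have "(\<Sum>u\<in>W - {w}. x u * adj_sum W E x u) = m - m * (x w)\<^sup>2"
  proof -
    have "(\<Sum>u\<in>W - {w}. x u * adj_sum W E x u) = (\<Sum>u\<in>W. x u * adj_sum W E x u) - x w * adj_sum W E x w"
      using assms(1,2) by (simp add: sum_diff1)
    also have "(\<Sum>u\<in>W. x u * adj_sum W E x u) = m * (\<Sum>v\<in>W. (x v)\<^sup>2)"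
      unfolding sum_distrib_left using ev by (intro sum.cong refl) (simp add: power2_eq_square)
    finally show ?thesis using norm ev[OF assms(2)] by (simp add: power2_eq_square)
  qed
  ultimately show ?thesis unfolding adj_form_def sum'
    using ev[OF assms(2)] by (simp add: right_diff_distrib sum_subtractf power2_eq_square)
qed

text \<open>
  With \<open>a\<close> the smallest squared entry, Cauchy-Schwarz at \<open>u\<close> gives
  \<open>m\<^sup>2 a \<le> d (1 - (k - d) a)\<close>, since the \<open>k - d\<close> vertices not adjacent to \<open>u\<close> carry weight at
  least \<open>a\<close> each.
\<close>

lemma (in simple_edges) ex_small_eigenvector_entry:
  fixes k d m e :: real
  assumes "finite W" "u \<in> W" and x: "\<And>v. 0 \<le> x v" and norm: "(\<Sum>v\<in>W. (x v)\<^sup>2) = 1"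
    and ev: "adj_sum W E x u = m * x u"
    and k: "k = card W" and d: "d = card (W \<inter> nbrs E u)" and m: "m > 0" "d * (d + e * k) \<le> m\<^sup>2"
  shows "\<exists>w\<in>W. (x w)\<^sup>2 * (k * (1 + e)) \<le> 1"
proof -
  have W: "W \<noteq> {}" using assms by auto
  obtain w where w: "w \<in> W" "\<And>v. v \<in> W \<Longrightarrow> x w \<le> x v"
    using ex_min_if_finite[of "x ` W"] assms(1) W by (fastforce simp: not_less)
  define a where "a = (x w)\<^sup>2"
  have a_le: "a \<le> (x v)\<^sup>2" if "v \<in> W" for v
    unfolding a_def using w(2)[OF that] x by (intro power_mono) auto
  define D where "D = W \<inter> nbrs E u"
  have fin: "finite D" "finite (W - D)" using assms(1) by (auto simp: D_def)
  have "m\<^sup>2 * a \<le> m\<^sup>2 * (x u)\<^sup>2" using a_le[OF assms(2)] by (intro mult_left_mono) auto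
  also have "\<dots> = (\<Sum>v\<in>D. x v)\<^sup>2"
  proof -
    have "m * x u = (\<Sum>v\<in>D. x v)"
      using assms(1) by (simp add: ev[symmetric] adj_sum_def D_def nbrs_def sum.If_cases)
    then show ?thesis by (simp flip: power_mult_distrib)
  qed
  also have "\<dots> \<le> (\<Sum>v\<in>D. (x v)\<^sup>2) * card D" by (rule sum_squared_le_sum_of_squares)
  also have "\<dots> \<le> (1 - (k - d) * a) * d"
  proof (rule mult_mono)
    have "(\<Sum>v\<in>W. (x v)\<^sup>2) = (\<Sum>v\<in>D. (x v)\<^sup>2) + (\<Sum>v\<in>W - D. (x v)\<^sup>2)"
      using sum.subset_diff[of D W "\<lambda>v. (x v)\<^sup>2"] assms(1) by (auto simp: D_def)
    moreover have "real (card (W - D)) * a \<le> (\<Sum>v\<in>W - D. (x v)\<^sup>2)"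
      using sum_bounded_below[of "W - D" a "\<lambda>v. (x v)\<^sup>2"] a_le by auto
    moreover have "real (card (W - D)) = k - d"
    proof -
      have "card (W - D) + card D = card W"
        using card_Diff_subset[OF fin(1), of W] card_mono[OF assms(1), of D] by (auto simp: D_def)
      then show ?thesis unfolding k d D_def[symmetric] by linarith
    qed
    ultimately show "(\<Sum>v\<in>D. (x v)\<^sup>2) \<le> 1 - (k - d) * a" using norm by simp
    then show "0 \<le> 1 - (k - d) * a" using sum_nonneg[of D "\<lambda>v. (x v)\<^sup>2"] by force
  qed (auto simp: d D_def)
  finally have main: "a * (m\<^sup>2 + d * (k - d)) \<le> d" by (simp add: algebra_simps)
  have a0: "a \<ge> 0" by (simp add: a_def)
  have "a * (k * (1 + e)) \<le> 1"
  proof (cases "d = 0")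
    case True
    then have "a * m\<^sup>2 \<le> 0" using main by simp
    then have "a = 0" using a0 m by (simp add: mult_le_0_iff)
    then show ?thesis by simp
  next
    case False
    then have d0: "d > 0" by (simp add: d)
    \<comment> \<open>Adding \<open>d * (k - d)\<close> to the hypothesis
      \<open>d * (d + e * k) \<le> m\<^sup>2\<close> gives the factor
      \<open>d * k * (1 + e)\<close>.\<close>
    have "a * (d * (k * (1 + e))) \<le> a * (m\<^sup>2 + d * (k - d))"
      using m a0 by (intro mult_left_mono) (auto simp: algebra_simps)
    then have "d * (a * (k * (1 + e))) \<le> d * 1" using main by (simp add: algebra_simps)
    then show ?thesis using d0 by (simp only: mult_le_cancel_left_pos)
  qed
  then show ?thesis using w(1) by (auto simp: a_def)
qed

text \<open>Deletion keeps at least the proportion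
  \<open>(1 - 2 a) / (1 - a) \<ge> 1 - 1 / b\<close> of the eigenvalue, where
  \<open>b = k * (1 + e) - 1\<close>, while a proportion \<open>1 - 1 / k\<close> would already
  preserve the ratio to the order. The gain comes from \<open>b - k = e * k - 1\<close>.\<close>

lemma ratio_increase:
  fixes k e a m m' :: real
  assumes "k \<ge> 2" "0 < e" "e \<le> 1" "e * k \<ge> 2" "m \<ge> k / 4" "0 \<le> a" "a * (k * (1 + e)) \<le> 1"
    and m': "m - 2 * m * a \<le> m' * (1 - a)"
  shows "m / k + e / (16 * (k - 1)) \<le> m' / (k - 1)"
proof -
  define b where "b = k + k * e - 1"
  have "k * e \<le> k" using assms by (intro mult_left_le) auto
  then have b: "b > 0" "b \<le> 2 * k" "b \<ge> k"
    using assms(1,4) unfolding b_def mult.commute[of k e] by linarith+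
  have ab: "a * b \<le> 1 - a" using assms by (simp add: b_def algebra_simps)
  have "2 * a \<le> k * (1 + e) * a" using assms by (intro mult_right_mono) (auto simp: algebra_simps)
  then have a1: "a < 1" using assms by (simp add: mult.commute)
  have m0: "m > 0" using assms by linarith
  have "m * (1 - a) * (b - 1) \<le> m' * (1 - a) * b"
  proof -
    have "m * (1 - a) * (b - 1) \<le> (m - 2 * m * a) * b"
    proof -
      have "m * (a * b) \<le> m * (1 - a)" using ab m0 by (intro mult_left_mono) auto
      then show ?thesis by (simp add: algebra_simps)
    qed
    also have "\<dots> \<le> m' * (1 - a) * b" using m' b by (intro mult_right_mono) auto
    finally show ?thesis .
  qed
  then have "(1 - a) * (m * (b - 1)) \<le> (1 - a) * (m' * b)" by (simp add: mult_ac)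
  then have mb: "m * (b - 1) \<le> m' * b" using a1 by (simp only: mult_le_cancel_left_pos diff_gt_0_iff_gt)
  have "b * (m * (k - 1) + e * k / 16) \<le> b * (m' * k)"
  proof -
    \<comment> \<open>The constant 16 combines \<open>b \<le> 2 * k\<close>,
      \<open>m \<ge> k / 4\<close> and \<open>e * k / 2 \<le> e * k - 1\<close>.\<close>
    have "b * (e * k / 16) \<le> (2 * k) * (e * k / 16)" using b assms by (intro mult_right_mono) auto
    also have "\<dots> = (k / 4) * (e * k / 2)" by simp
    also have "\<dots> \<le> m * (k * e - 1)" using assms by (intro mult_mono) (auto simp: algebra_simps)
    also have "\<dots> = m * (b - k)" by (simp add: b_def)
    finally have "b * (m * (k - 1) + e * k / 16) \<le> k * (m * (b - 1))" by (simp add: algebra_simps)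
    also have "\<dots> \<le> k * (m' * b)" using mb assms by (intro mult_left_mono) auto
    finally show ?thesis by (simp add: mult_ac)
  qed
  then have "m * (k - 1) + e * k / 16 \<le> m' * k" using b(1) by (simp only: mult_le_cancel_left_pos)
  then have "(m * (k - 1) + e * k / 16) / (k * (k - 1)) \<le> m' * k / (k * (k - 1))"
    using assms by (intro divide_right_mono) auto
  moreover have "(m * (k - 1) + e * k / 16) / (k * (k - 1)) = m / k + e / (16 * (k - 1))"
    using assms by (simp add: divide_simps)
  ultimately show ?thesis using assms by simp
qed

text \<open>The low degree of \<open>u\<close> only forces a small entry somewhere; the vertex
  deleted is the \<open>w\<close> carrying that entry.\<close>

lemma (in simple_edges) delete_low_degree_vertex:
  fixes k e :: real and r :: nat
  assumes "r \<ge> 2" "finite W" "u \<in> W" and k: "k = card W"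
    and e: "0 < e" "e \<le> 1 / 2" "e * k \<ge> 2" "e * k\<^sup>2 \<ge> 2 * r"
    and mu: "top_eigenvalue E W \<ge> (1 - 1 / r) * k - r / k"
    and low: "real (card (W \<inter> nbrs E u)) \<le> (1 - 1 / r - e) * k"
  shows "\<exists>w\<in>W. W - {w} \<noteq> {} \<and> top_eigenvalue E W / k + e / (16 * (k - 1)) \<le> top_eigenvalue E (W - {w}) / (k - 1)"
proof -
  have W: "W \<noteq> {}" using assms by auto
  define m where "m = top_eigenvalue E W"
  define h where "h = 1 - 1 / real r"
  define d where "d = real (card (W \<inter> nbrs E u))"
  have h: "1 / 2 \<le> h" "h \<le> 1" using \<open>r \<ge> 2\<close> by (auto simp: h_def field_simps)
  have "e * k \<le> 1 / 2 * k" using e by (intro mult_right_mono) (auto simp: k)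
  then have k4: "k \<ge> 4" using e by simp
  have "e * k\<^sup>2 \<le> 1 / 2 * k\<^sup>2" using e by (intro mult_right_mono) auto
  then have "4 * r \<le> k * k" using e by (simp add: power2_eq_square)
  then have rk: "r / k \<le> k / 4" using k4 by (simp add: field_simps)
  have hk: "k / 2 \<le> h * k" using h k4 by simp
  have m: "h * k - r / k \<le> m" using mu by (simp add: h_def m_def)
  then have m4: "k / 4 \<le> m" using hk rk by linarith
  \<comment> \<open>The product is at most \<open>h * (h - e) * k^2\<close>. The saving
    \<open>h * e * k^2\<close> outweighs the cross term \<open>2 * h * r\<close> of
    \<open>(h * k - r / k)^2\<close>.\<close>
  have "d * (d + e * k) \<le> m\<^sup>2"
  proof -
    have "d * (d + e * k) \<le> ((h - e) * k) * (h * k)"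
      using low e k4 by (intro mult_mono) (auto simp: d_def h_def algebra_simps)
    also have "\<dots> = h * h * (k * k) - h * (e * k\<^sup>2)" by (simp add: algebra_simps power2_eq_square)
    also have "\<dots> \<le> h * h * (k * k) - h * (2 * r)"
      using h e by (intro diff_left_mono mult_left_mono) auto
    also have "\<dots> \<le> (h * k - r / k)\<^sup>2"
    proof -
      have "(h * k - r / k)\<^sup>2 = h * h * (k * k) - h * (2 * r) + (r / k)\<^sup>2"
        using k4 by (simp add: power2_eq_square algebra_simps)
      then show ?thesis by simp
    qed
    also have "\<dots> \<le> m\<^sup>2" using m hk rk k4 by (intro power_mono) linarith+
    finally show ?thesis .
  qed
  obtain x where x: "\<And>v. 0 \<le> x v" "(\<Sum>v\<in>W. (x v)\<^sup>2) = 1" "\<And>u. u \<in> W \<Longrightarrow> adj_sum W E x u = m * x u"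
    using ex_top_eigenvector[OF \<open>finite W\<close> W symE] unfolding m_def by blast
  have "m > 0" using m4 k4 by linarith
  then obtain w where w: "w \<in> W" "(x w)\<^sup>2 * (k * (1 + e)) \<le> 1"
    using ex_small_eigenvector_entry[OF assms(2,3) x(1,2) x(3)[OF assms(3)] k d_def _ \<open>d * (d + e * k) \<le> m\<^sup>2\<close>] by blast
  have ne: "W - {w} \<noteq> {}"
  proof
    assume "W - {w} = {}"
    then have "W = {w}" using w(1) by auto
    then show False using k4 by (simp add: k)
  qed
  have "adj_form (W - {w}) E x x \<le> top_eigenvalue E (W - {w}) * (\<Sum>v\<in>W - {w}. (x v)\<^sup>2)"
    using assms(2) ne symE by (intro rayleigh_le) auto
  moreover have "(\<Sum>v\<in>W - {w}. (x v)\<^sup>2) = 1 - (x w)\<^sup>2"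
    using assms(2) w(1) x(2) by (simp add: sum_diff1)
  ultimately have "m - 2 * m * (x w)\<^sup>2 \<le> top_eigenvalue E (W - {w}) * (1 - (x w)\<^sup>2)"
    using adj_form_delete[OF assms(2) w(1) x(3,2)] by simp
  then have "m / k + e / (16 * (k - 1)) \<le> top_eigenvalue E (W - {w}) / (k - 1)"
    using k4 e m4 w(2) by (intro ratio_increase[where a = "(x w)\<^sup>2"]) auto
  then show ?thesis using w(1) ne by (auto simp: m_def)
qed

lemma (in simple_edges) ex_large_min_degree_subset:
  fixes e :: real and r n :: nat
  assumes "r \<ge> 2" "finite V" "card V = n" and e: "0 < e" "e \<le> 1 / 2"
    and mu: "top_eigenvalue E V \<ge> (1 - 1 / r) * n - r / n"
    and big: "2 * r / e * exp (32 / e) \<le> n"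
  shows "\<exists>W\<subseteq>V. W \<noteq> {} \<and> ln n - 32 / e \<le> ln (card W) \<and>
    (\<forall>u\<in>W. (1 - 1 / r - e) * card W < real (card (W \<inter> nbrs E u))) \<and>
    (W = V \<or> (1 - 1 / r) * card W < top_eigenvalue E W)"
proof -
  have e32: "32 / e \<ge> 64" using e by (simp add: field_simps)
  have exp1: "exp (32 / e) \<ge> 1 + 32 / e" by (rule exp_ge_add_one_self)
  have re: "2 * r / e > 0" using assms by simp
  have "2 * r / e * 64 \<le> 2 * r / e * exp (32 / e)" using exp1 e32 re
    by (intro mult_left_mono) linarith+
  moreover have "32 * r / e = 16 * (2 * r / e)" by simp
  ultimately have n_gt: "32 * r / e < n" using big re by linarith
  have n0: "n > 0"
  proof (rule ccontr)
    assume "\<not> n > 0"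
    moreover have "32 * r / e > 0" using assms by simp
    ultimately show False using n_gt by simp
  qed
  have V: "V \<noteq> {}" using n0 assms by auto
  \<comment> \<open>The coefficient \<open>e / 32\<close> is half of the gain \<open>e / 16\<close>
    from a deletion, while the logarithm drops by at most \<open>1 / (k - 1)\<close>; so deletion
    raises \<open>F\<close>.\<close>
  define F where "F W = top_eigenvalue E W / card W + e / 32 * ln (card W)" for W
  define P where "P = {W. W \<subseteq> V \<and> W \<noteq> {}}"
  have "finite P" unfolding P_def using assms(2) by simp
  moreover have "P \<noteq> {}" using V by (auto simp: P_def)
  ultimately have "Max (F ` P) \<in> F ` P" by (intro Max_in) auto
  then obtain W where "W \<in> P" "Max (F ` P) = F W" by auto
  then have W: "W \<in> P" "\<And>W'. W' \<in> P \<Longrightarrow> F W' \<le> F W"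
    using Max_ge[of "F ` P"] \<open>finite P\<close> by auto
  have WV: "W \<subseteq> V" "W \<noteq> {}" using W(1) by (auto simp: P_def)
  have finW: "finite W" using WV assms(2) finite_subset by blast
  define k where "k = real (card W)"
  have k1: "k \<ge> 1" using finW WV by (simp add: k_def Suc_le_eq card_gt_0_iff)
  have FV: "F V \<le> F W" using V by (intro W) (auto simp: P_def)
  \<comment> \<open>The eigenvalue ratio stays in \<open>[0, 1]\<close>, so its rise from
    \<open>V\<close> to \<open>W\<close> is at most 1, which limits the loss in the
    logarithm.\<close>
  have "e / 32 * ln n \<le> 1 + e / 32 * ln k"
  proof -
    have "0 \<le> top_eigenvalue E V / n" using top_eigenvalue_nonneg[OF assms(2) V symE] by simp
    moreover have "top_eigenvalue E W / k \<le> 1"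
      using top_eigenvalue_le_card[OF finW WV(2) symE] k1 by (simp add: k_def)
    ultimately show ?thesis using FV assms(3) by (simp add: F_def k_def)
  qed
  then have ln_k: "ln n - 32 / e \<le> ln k" using e by (simp add: field_simps)
  \<comment> \<open>Equivalently \<open>e * k \<ge> 2 * r\<close>, from which both size conditions
    on \<open>e\<close> and \<open>k\<close> in \<open>delete_low_degree_vertex\<close>
    follow.\<close>
  have k_ge: "k \<ge> 2 * r / e"
  proof -
    have "exp (ln n - 32 / e) \<le> exp (ln k)" using ln_k by simp
    then have "n / exp (32 / e) \<le> k" using n0 k1 by (simp add: exp_diff)
    moreover have "2 * r / e \<le> n / exp (32 / e)" using big by (simp add: field_simps)
    ultimately show ?thesis by simp
  qed
  \<comment> \<open>If at least one vertex is lost, the ratio must rise by at least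
    \<open>e / (32 * n)\<close> to compensate the logarithm. This exceeds the defect
    \<open>r / n^2\<close> of the ratio at \<open>V\<close>, since
    \<open>n > 32 * r / e\<close>.\<close>
  have dense: "W = V \<or> (1 - 1 / r) * k < top_eigenvalue E W"
  proof (cases "W = V")
    case False
    then have "W \<subset> V" using WV by auto
    then have "card W < card V" by (rule psubset_card_mono[OF assms(2)])
    then have kn: "k \<le> real n - 1" using assms(3) by (simp add: k_def)
    have "ln n - ln k \<ge> 1 / n"
    proof -
      have "ln k - ln n = ln (k / n)" using k1 n0 by (simp add: ln_div)
      also have "\<dots> \<le> k / n - 1" using k1 n0 by (intro ln_le_minus_one) simp
      also have "\<dots> \<le> (real n - 1) / n - 1" using kn n0 by (intro diff_right_mono divide_right_mono) auto
      also have "\<dots> = - (1 / n)" using n0 by (simp add: field_simps)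
      finally show ?thesis by simp
    qed
    then have "e / 32 * (1 / n) \<le> e / 32 * (ln n - ln k)" using e by (intro mult_left_mono) auto
    then have "top_eigenvalue E V / n + e / 32 * (1 / n) \<le> top_eigenvalue E W / k"
      using FV assms(3) by (simp add: F_def k_def algebra_simps)
    moreover have "(1 - 1 / r) - r / n / n \<le> top_eigenvalue E V / n"
    proof -
      have "((1 - 1 / r) * n - r / n) / n \<le> top_eigenvalue E V / n"
        using mu by (intro divide_right_mono) auto
      then show ?thesis using n0 by (simp add: diff_divide_distrib)
    qed
    moreover have "r / n / n < e / 32 * (1 / n)"
    proof -
      have "r / n < e / 32" using n_gt e n0 by (simp add: field_simps)
      then have "r / n / n < e / 32 / n" using n0 by (intro divide_strict_right_mono) auto
      then show ?thesis by simp
    qed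
    ultimately have "1 - 1 / r < top_eigenvalue E W / k" by linarith
    then show ?thesis using k1 by (simp add: pos_less_divide_eq)
  qed simp
  have "(1 - 1 / r - e) * k < real (card (W \<inter> nbrs E u))" if u: "u \<in> W" for u
  proof (rule ccontr)
    assume low: "\<not> ?thesis"
    have ek: "e * k \<ge> 2 * r" using k_ge e by (simp add: field_simps)
    have "\<exists>w\<in>W. W - {w} \<noteq> {} \<and>
      top_eigenvalue E W / k + e / (16 * (k - 1)) \<le> top_eigenvalue E (W - {w}) / (k - 1)"
    proof (rule delete_low_degree_vertex[OF assms(1) finW u k_def e])
      show "2 \<le> e * k" using ek assms(1) by linarith
      have "e * k * 1 \<le> e * k * k" using k1 e by (intro mult_left_mono) auto
      then show "real (2 * r) \<le> e * k\<^sup>2" using ek by (simp add: power2_eq_square)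
      show "(1 - 1 / real r) * k - real r / k \<le> top_eigenvalue E W"
        using dense
      proof
        assume "W = V"
        then show ?thesis using mu assms(3) by (simp add: k_def)
      next
        assume "(1 - 1 / real r) * k < top_eigenvalue E W"
        moreover have "r / k \<ge> 0" using k1 by simp
        ultimately show ?thesis by linarith
      qed
    qed (use low in simp)
    then obtain w where w: "w \<in> W" "W - {w} \<noteq> {}"
      "top_eigenvalue E W / k + e / (16 * (k - 1)) \<le> top_eigenvalue E (W - {w}) / (k - 1)" by blast
    have card': "real (card (W - {w})) = k - 1"
      using w(1) finW k1 by (simp add: k_def of_nat_diff)
    have k2: "k - 1 > 0"
      using w(2) finW card' by (metis card_gt_0_iff finite_Diff of_nat_0_less_iff)
    have "ln k - ln (k - 1) \<le> 1 / (k - 1)"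
    proof -
      have "ln k - ln (k - 1) = ln (k / (k - 1))" using k1 k2 by (simp add: ln_div)
      also have "\<dots> \<le> k / (k - 1) - 1" using k1 k2 by (intro ln_le_minus_one) simp
      also have "\<dots> = 1 / (k - 1)" using k2 by (simp add: field_simps)
      finally show ?thesis .
    qed
    then have "e / 32 * (ln k - ln (k - 1)) \<le> e / 32 * (1 / (k - 1))" using e by (intro mult_left_mono) auto
    also have "\<dots> < e / (16 * (k - 1))" using e k2 by (simp add: field_simps)
    finally have "F W < F (W - {w})"
      using w(3) unfolding F_def card' k_def[symmetric] right_diff_distrib by linarith
    moreover have "F (W - {w}) \<le> F W" using WV w by (intro W) (auto simp: P_def)
    ultimately show False by simp
  qed
  then show ?thesis using WV ln_k dense by (intro exI[of _ W]) (auto simp: k_def)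
qed

section \<open>The theorem\<close>

text \<open>The subgraph is the image of the pattern under the embedding \<open>f\<close>, with arcs
  mapped componentwise; injectivity on arcs is inherited from \<open>f\<close>.\<close>

lemma contains_plus_imp_subgraph:
  fixes G :: "'a pair_pre_digraph"
  assumes "pair_graph G" "contains_plus (parcs G) r s" "r \<ge> 2" "s \<ge> 2"
  shows "\<exists>H. subgraph H (with_proj G) \<and>
    digraph_iso H (with_proj (complete_multipartite_plus (replicate r s)))"
proof -
  define K where "K = complete_multipartite_plus (replicate r s)"
  obtain f where f: "inj_on f ({..<r} \<times> {..<s})" "(f (0, 0), f (0, 1)) \<in> parcs G"
    "\<And>i j a b. i < r \<Longrightarrow> j < r \<Longrightarrow> a < s \<Longrightarrow> b < s \<Longrightarrow> i \<noteq> j \<Longrightarrow> (f (i, a), f (j, b)) \<in> parcs G"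
    using assms(2) unfolding contains_plus_def by blast
  interpret G: pair_graph G by fact
  have gK: "pair_graph K" unfolding K_def
    by (rule pair_graph_complete_multipartite_plus) (use assms in auto)
  then interpret K: pair_graph K .
  have vK: "pverts K = {..<r} \<times> {..<s}"
    by (auto simp: K_def complete_multipartite_plus_def pverts_complete_multipartite)
  have sym: "(v, u) \<in> parcs G" if "(u, v) \<in> parcs G" for u v
    using G.sym_arcs that by (auto simp: symmetric_def sym_def)
  have aK: "(f u, f v) \<in> parcs G" if "(u, v) \<in> parcs K" for u v
    using that f(2,3) sym[OF f(2)]
    by (auto simp: K_def complete_multipartite_plus_def parcs_complete_multipartite
        pverts_complete_multipartite)
  define hom where "hom = \<lparr>iso_verts = f, iso_arcs = map_prod f f,
    iso_head = (snd :: 'a \<times> 'a \<Rightarrow> 'a), iso_tail = (fst :: 'a \<times> 'a \<Rightarrow> 'a)\<rparr>"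
  define H where "H = app_iso hom (with_proj K)"
  have wfK: "wf_digraph (with_proj K)" by unfold_locales
  have sub: "parcs K \<subseteq> pverts K \<times> pverts K" using K.in_arcsD1 K.in_arcsD2 by auto
  have "pre_digraph.digraph_isomorphism (with_proj K) hom"
    unfolding pre_digraph.digraph_isomorphism_def
    using wfK f(1) inj_on_subset[OF map_prod_inj_on[OF f(1) f(1)]] sub
    by (auto simp: hom_def vK)
  then have "digraph_iso (with_proj K) H" unfolding digraph_iso_def H_def by blast
  then have iso: "digraph_iso H (with_proj K)" by (rule digraph_iso_swap[OF wfK])
  have "f v \<in> pverts G" if "v \<in> pverts K" for v
  proof -
    obtain i a where v: "v = (i, a)" "i < r" "a < s"
      using \<open>v \<in> pverts K\<close> unfolding vK by blast
    \<comment> \<open>A second part exists since \<open>r \<ge> 2\<close>; the arc into it certifies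
      that \<open>f v\<close> is a vertex of \<open>G\<close>.\<close>
    define j where "j = (if i = 0 then 1 else 0 :: nat)"
    have "(f (i, a), f (j, a)) \<in> parcs G" using v assms by (intro f(3)) (auto simp: j_def)
    then show ?thesis using v G.in_arcsD1 by blast
  qed
  then have "subgraph H (with_proj G)"
    unfolding subgraph_def compatible_def H_def
    using aK sub G.wf_digraph_axioms
    by (auto simp: hom_def wf_digraph_def)
  then show ?thesis using iso unfolding K_def by blast
qed

text \<open>The inequalities needed for \<open>e = 1 / (80 * r^3)\<close>: the part size is at least
  2, \<open>n\<close> is large enough for \<open>ex_large_min_degree_subset\<close>, and the subset
  found there is large enough for \<open>multipartite_if_plus_free\<close>. All are compared on the
  logarithmic scale with \<open>ln n \<ge> 2 * Y\<close>, where \<open>Y = 1 / c\<close>.\<close>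

lemma theorem_constants:
  fixes r n :: nat and c :: real
  assumes "r \<ge> 2" and c: "c = 1 / real r ^ ((2 * r + 9) * (r + 1))" and n: "real n \<ge> exp (2 / c)"
  shows "2 \<le> nat \<lfloor>c * ln (real n)\<rfloor>"
    and "2 * r / (1 / (80 * real r ^ 3)) * exp (32 / (1 / (80 * real r ^ 3))) \<le> n"
    and "ln n - 32 / (1 / (80 * real r ^ 3)) \<le> ln k \<Longrightarrow> 0 < k \<Longrightarrow>
      real (32 * r\<^sup>2 * 4 ^ (r * (64 * r\<^sup>2 * nat \<lfloor>c * ln (real n)\<rfloor>) * (2 * r) ^ (r - 1))) \<le> k"
proof -
  define R where "R = real r"
  define Y where "Y = R ^ ((2 * r + 9) * (r + 1))"
  define s where "s = nat \<lfloor>c * ln (real n)\<rfloor>"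
  have R: "R \<ge> 2" using assms by (simp add: R_def)
  have pow: "R ^ a \<le> R ^ b" if "a \<le> b" for a b using R that by (intro power_increasing) auto
  have two: "2 ^ a \<le> R ^ a" for a using R by (intro power_mono) auto
  have Y0: "Y > 0" using R by (simp add: Y_def)
  have n0: "n > 0" using n exp_gt_zero[of "2 / c"] by (cases n) (auto simp: not_le)
  have "ln (exp (2 / c)) \<le> ln n" using n n0 by (subst ln_le_cancel_iff) auto
  then have lnn: "2 * Y \<le> ln n" by (simp add: c Y_def R_def)
  have cln: "c * ln n = ln n / Y" by (simp add: c Y_def R_def)
  have "2 \<le> c * ln n" using lnn Y0 by (simp add: cln field_simps)
  then show "2 \<le> nat \<lfloor>c * ln (real n)\<rfloor>" by (intro le_nat_floor) simp
  have s: "real s \<le> ln n / Y" unfolding s_def cln[symmetric] using \<open>2 \<le> c * ln n\<close> by simp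
  have "3 \<le> r + 1" using assms by simp
  then have exponent: "(2 * r + 9) * 3 \<le> (2 * r + 9) * (r + 1)" by (intro mult_left_mono) auto
  have "16 \<le> (2 * r + 9) * 3" using assms(1) by simp
  then have "16 \<le> (2 * r + 9) * (r + 1)" using exponent by (rule order_trans)
  then have Y16: "R ^ 16 \<le> Y" unfolding Y_def by (rule pow)
  have a: "2560 * R ^ 3 \<le> R ^ 15"
  proof -
    have "2560 * R ^ 3 \<le> R ^ 12 * R ^ 3" using two[of 12] R by (intro mult_right_mono) auto
    then show ?thesis by (simp flip: power_add)
  qed
  have b: "160 * R ^ 4 \<le> R ^ 15"
  proof -
    have "160 * R ^ 4 \<le> R ^ 11 * R ^ 4" using two[of 11] R by (intro mult_right_mono) auto
    then show ?thesis by (simp flip: power_add)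
  qed
  have b': "32 * R ^ 2 \<le> R ^ 15"
  proof -
    have "32 * R ^ 2 \<le> R ^ 13 * R ^ 2" using two[of 13] R by (intro mult_right_mono) auto
    then show ?thesis by (simp flip: power_add)
  qed
  have d: "2 * R ^ 15 \<le> Y"
  proof -
    have "2 * R ^ 15 \<le> R * R ^ 15" using R by (intro mult_right_mono) auto
    then show ?thesis using Y16 by (simp flip: power_Suc)
  qed
  have "160 * R ^ 4 \<le> exp (160 * R ^ 4)" using exp_ge_add_one_self[of "160 * R ^ 4"] by linarith
  then have "160 * R ^ 4 * exp (2560 * R ^ 3) \<le> exp (160 * R ^ 4) * exp (2560 * R ^ 3)"
    by (rule mult_right_mono) simp
  also have "\<dots> = exp (160 * R ^ 4 + 2560 * R ^ 3)" by (simp add: exp_add)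
  also have "\<dots> \<le> exp (ln n)" using a b d lnn Y0 unfolding exp_le_cancel_iff by linarith
  also have "\<dots> = n" using n0 by simp
  finally show "2 * r / (1 / (80 * real r ^ 3)) * exp (32 / (1 / (80 * real r ^ 3))) \<le> n"
    by (simp add: R_def power_numeral_reduce mult_ac)
  assume k: "ln n - 32 / (1 / (80 * real r ^ 3)) \<le> ln k" "0 < k"
  define N where "N = r * (64 * r\<^sup>2 * s) * (2 * r) ^ (r - 1)"
  \<comment> \<open>From \<open>8 * N = 512 * R^3 * (2 * R)^(r - 1) * s\<close>, the bounds
    \<open>512 \<le> R^9\<close> and \<open>2 * R \<le> R^2\<close> give a power of \<open>R\<close>
    below \<open>Y\<close>, and \<open>Y * s \<le> ln n\<close>.\<close>
  have N: "8 * real N \<le> ln n"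
  proof -
    have "(2 * R) ^ (r - 1) \<le> (R ^ 2) ^ (r - 1)"
      using R by (intro power_mono) (auto simp: power2_eq_square)
    also have "\<dots> = R ^ (2 * (r - 1))" by (simp add: power_mult)
    finally have p: "(2 * R) ^ (r - 1) \<le> R ^ (2 * (r - 1))" .
    have "8 * real N = 512 * R ^ 3 * (2 * R) ^ (r - 1) * s"
      by (simp add: N_def R_def power2_eq_square power3_eq_cube)
    also have "\<dots> \<le> R ^ 9 * R ^ 3 * R ^ (2 * (r - 1)) * s"
      using R p two[of 9] by (intro mult_right_mono mult_mono) auto
    also have "\<dots> = R ^ (12 + 2 * (r - 1)) * s" by (simp add: power_add)
    also have "\<dots> \<le> Y * s"
    proof -
      have "12 + 2 * (r - 1) \<le> (2 * r + 9) * 3" using assms(1) by simp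
      then have "12 + 2 * (r - 1) \<le> (2 * r + 9) * (r + 1)" using exponent by (rule order_trans)
      then show ?thesis unfolding Y_def by (intro mult_right_mono pow) auto
    qed
    also have "\<dots> \<le> Y * (ln n / Y)" using s Y0 by (intro mult_left_mono) auto
    also have "\<dots> = ln n" using Y0 by simp
    finally show ?thesis .
  qed
  have "ln (32 * R\<^sup>2 * 4 ^ N) = ln (32 * R\<^sup>2) + N * ln 4"
    using R by (simp add: ln_mult ln_realpow)
  also have "\<dots> \<le> 32 * R\<^sup>2 + N * 3"
  proof -
    have "ln (32 * R\<^sup>2) \<le> 32 * R\<^sup>2 - 1" using R by (intro ln_le_minus_one) auto
    moreover have "ln (4 :: real) \<le> 4 - 1" by (intro ln_le_minus_one) auto
    then have "N * ln 4 \<le> real N * 3" by (intro mult_left_mono) auto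
    ultimately show ?thesis by linarith
  qed
  \<comment> \<open>The term \<open>3 * N\<close> takes at most \<open>3/8\<close> of
    \<open>ln n\<close>; \<open>32 * R^2 + 2560 * R^3 \<le> 2 * R^15 \<le> Y\<close> takes at most
    half.\<close>
  also have "\<dots> \<le> ln n - 2560 * R ^ 3"
    using N lnn d a b' by linarith
  also have "\<dots> \<le> ln k" using k by (simp add: R_def)
  finally have "32 * R\<^sup>2 * 4 ^ N \<le> k" using R k(2) by (subst (asm) ln_le_cancel_iff) auto
  then show "real (32 * r\<^sup>2 * 4 ^ (r * (64 * r\<^sup>2 * nat \<lfloor>c * ln (real n)\<rfloor>) * (2 * r) ^ (r - 1))) \<le> k"
    by (simp only: N_def s_def R_def of_nat_mult of_nat_power of_nat_numeral)
qed

theorem theorem3: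
  fixes r n :: nat and c :: real and G :: "'a pair_pre_digraph"
  assumes "r \<ge> 2"
    and "c = 1 / real r ^ ((2 * r + 9) * (r + 1))"
    and "real n \<ge> exp (2 / c)"
    and "pair_graph G"
    and "card (pverts G) = n"
    and "largest_eigenvalue G > largest_eigenvalue (turan_graph r n)"
  shows "\<exists>H. subgraph H (with_proj G) \<and>
    digraph_iso H (with_proj (complete_multipartite_plus (replicate r (nat \<lfloor>c * ln (real n)\<rfloor>))))"
proof -
  define s where "s = nat \<lfloor>c * ln (real n)\<rfloor>"
  define e where "e = 1 / (80 * real r ^ 3)"
  define V where "V = pverts G"
  define E where "E = parcs G"
  note const = theorem_constants[OF assms(1-3), folded e_def s_def]
  interpret G: pair_graph G by fact
  interpret simple_edges E
    using G.sym_arcs by unfold_locales (auto simp: E_def symmetric_def sym_def dest: G.no_loops)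
  have V: "finite V" "card V = n" using assms by (auto simp: V_def)
  have n: "n > 0" using assms(3) exp_gt_zero[of "2 / c"] by (cases n) (auto simp: not_le)
  have e: "0 < e" "e \<le> 1 / 2"
  proof -
    have "2 ^ 3 \<le> real r ^ 3" using assms(1) by (intro power_mono) auto
    then have "2 \<le> 80 * real r ^ 3" by simp
    then have "1 / (80 * real r ^ 3) \<le> 1 / 2" using assms(1) by (intro divide_left_mono) auto
    then show "0 < e" "e \<le> 1 / 2" using assms(1) by (auto simp: e_def)
  qed
  have mu: "top_eigenvalue E V > largest_eigenvalue (turan_graph r n)"
    using assms(6) by (simp add: E_def V_def top_eigenvalue_graph)
  have muV: "top_eigenvalue E V \<ge> (1 - 1 / r) * n - r / n"
    using mu largest_eigenvalue_turan_graph_ge[of r n] assms(1) n by linarith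
  obtain W where W: "W \<subseteq> V" "W \<noteq> {}" "ln n - 32 / e \<le> ln (card W)"
    "\<And>u. u \<in> W \<Longrightarrow> (1 - 1 / r - e) * card W < real (card (W \<inter> nbrs E u))"
    "W = V \<or> (1 - 1 / r) * card W < top_eigenvalue E W"
    using ex_large_min_degree_subset[OF assms(1) V e muV const(2)] by blast
  have finW: "finite W" using W(1) V(1) finite_subset by blast
  have "contains_plus E r s"
  proof (rule ccontr)
    assume free: "\<not> contains_plus E r s"
    have "\<exists>p. \<forall>v\<in>W. p v < r \<and> (\<forall>u\<in>W. (u, v) \<in> E \<longrightarrow> p u \<noteq> p v)"
    proof (rule multipartite_if_plus_free[OF assms(1) const(1) finW _ _ free])
      fix v assume v: "v \<in> W"
      have "card (W - nbrs E v) + card (W \<inter> nbrs E v) = card W"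
        using card_Int_Diff[OF finW, of "nbrs E v"] by simp
      then have "real (card (W - nbrs E v)) = real (card W) - card (W \<inter> nbrs E v)" by linarith
      then show "real (card (W - nbrs E v)) \<le> (1 / r + 1 / (80 * real r ^ 3)) * card W"
        using W(4)[OF v] unfolding e_def[symmetric] by (simp add: algebra_simps)
    next
      have "0 < real (card W)" using finW W(2) by (simp add: card_gt_0_iff)
      then have "real (32 * r\<^sup>2 * 4 ^ (r * (64 * r\<^sup>2 * s) * (2 * r) ^ (r - 1))) \<le> real (card W)"
        by (rule const(3)[OF W(3)])
      then show "32 * r\<^sup>2 * 4 ^ (r * (64 * r\<^sup>2 * s) * (2 * r) ^ (r - 1)) \<le> card W"
        by (simp only: of_nat_le_iff)
    qed
    then obtain p where p: "\<And>v. v \<in> W \<Longrightarrow> p v < r"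
      "\<And>u v. u \<in> W \<Longrightarrow> v \<in> W \<Longrightarrow> (u, v) \<in> E \<Longrightarrow> p u \<noteq> p v" by blast
    have r: "r > 0" using assms(1) by simp
    \<comment> \<open>The first bound rules out a proper subset \<open>W\<close>, since that would
      be too dense; for \<open>W = V\<close> the comparison with the Turan graph contradicts the
      hypothesis on \<open>G\<close>.\<close>
    have "top_eigenvalue E W \<le> (1 - 1 / r) * card W"
      by (rule multipartite_top_eigenvalue_le[OF r finW W(2) symE p])
    then have "W = V" using W(5) by auto
    moreover have "top_eigenvalue E W \<le> largest_eigenvalue (turan_graph r (card W))"
      by (rule multipartite_top_eigenvalue_le_turan[OF r finW W(2) symE p])
    ultimately show False using mu V(2) by simp
  qed
  then show ?thesis
    using contains_plus_imp_subgraph[OF assms(4) _ assms(1) const(1)] by (simp add: E_def s_def)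
qed

end
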